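(* Assume that $g$ and $f^\ast$ are $\omega_g$- and $\omega_{f^\ast}$-strongly convex, respectively ($\omega_g,\omega_{f^\ast}>0$). Let $\tau,\sigma>0$ with $\lambda=\sigma/\tau$, let $L=\|K\|$, and let $(X^n,Y^n)$ and $(\tilde X^n,\tilde Y^n)$ be two instances of the primal-dual Langevin iteration $$\left\{\begin{array}{l}Y^{n+1}=\mathrm{prox}_{\sigma f^\ast}(Y^n+\sigma KX_\theta^n)\\ X^{n+1}=\mathrm{prox}_{\tau g}(X^n-\tau K^TY^{n+1})+\sqrt{2\tau}\,\xi^{n+1}\\ X_\theta^{n+1}=X^{n+1}+\theta(X^{n+1}-X^n)\end{array}\right.$$ with $X_\theta^0=X^0$, coupled by using the same independent Gaussian inputs $\xi^{n+1}\sim\mathrm{N}(0,I_d)$, with $(X^0,Y^0)\sim\pi_0$, $(\tilde X^0,\tilde Y^0)\sim\tilde\pi_0$, and with extrapolation parameter $\theta$ satisfying $$\max\{(1+2\omega_g\tau)^{-1},(1+2\omega_{f^\ast}\sigma)^{-1}\}\le\theta<1$$ and $\theta\sigma\tau L^2\le1$. Denote by $\pi_n,\tilde\pi_n$ the laws of $(X^n,Y^n)$, $(\tilde X^n,\tilde Y^n)$ and by $\mu_n,\tilde\mu_n$ the laws of $X^n,\tilde X^n$, and set $\tilde\lambda=\frac{1+2\omega_g\tau}{1+2\omega_{f^\ast}\sigma}\,\lambda$. Then for all $N$ $$\mathcal{W}_2(\mu_N,\tilde\mu_N)\le\theta^{N/2}\,\mathcal{T}_{1,\tilde\lambda^{-1}}(\pi_0,\tilde\pi_0),$$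 and if $\theta\sigma\tau L^2<1$, then with $\tilde C=(1-\theta\tau\sigma L^2)^{-1/2}$ $$\mathcal{T}_{1,\tilde\lambda^{-1}}(\pi_N,\tilde\pi_N)\le\tilde C\,\theta^{N/2}\,\mathcal{T}_{1,\tilde\lambda^{-1}}(\pi_0,\tilde\pi_0).$$ In the latter case a stationary distribution $\pi_{\lambda,\tau}$ exists and the distribution $\pi_N$ of samples converges to $\pi_{\lambda,\tau}$ as $N\to\infty$.
   Context: $\mathcal{X}=\mathbb{R}^d$, $\mathcal{Y}=\mathbb{R}^m$, $\mathcal{Z}=\mathcal{X}\times\mathcal{Y}$; $K:\mathcal{X}\to\mathcal{Y}$ is linear with Euclidean operator norm $\|K\|$; $f:\mathcal{Y}\to\mathbb{R}\cup\{\infty\}$ and $g:\mathcal{X}\to\mathbb{R}\cup\{\infty\}$ are convex and lower semicontinuous with $0<\int\exp(-f(Kx)-g(x))dx<\infty$; $f^\ast(y)=\sup_x\{\langle x,y\rangle-f(x)\}$; $\mathrm{prox}_{\gamma\phi}=(\mathrm{id}+\gamma\partial\phi)^{-1}$. The $\xi^n$ are i.i.d. and independent of the initial values; initial laws have finite second moment. $\mathcal{W}_2$ is the 2-Wasserstein distance, and for $a,b>0$ $$\mathcal{T}_{a,b}(\pi,\tilde\pi)=\inf\left(\mathbb{E}\left[a\|x-\tilde x\|^2+b\|y-\tilde y\|^2\right]\right)^{1/2},$$ the infimum over all couplings of $(x,y)\sim\pi$ and $(\tilde x,\tilde y)\sim\tilde\pi$, for $\pi,\tilde\pi\in\mathcal{P}_2(\mathcal{Z})$.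 *)

theory Defs
  imports "HOL-Probability.Probability"
begin

section \<open>Convex analysis for extended-real functions\<close>

definition lsc :: "('a::topological_space \<Rightarrow> ereal) \<Rightarrow> bool" where
  "lsc h \<longleftrightarrow> (\<forall>x. h x \<le> Liminf (at x) h)"

text \<open>The next two definitions are meant for functions that avoid \<open>-\<infinity>\<close>; the right-hand sides
  are then never \<open>\<infinity> - \<infinity>\<close>, and \<open>0 * \<infinity> = 0\<close> makes the endpoints \<open>u = 0\<close>, \<open>v = 0\<close> harmless.\<close>

definition econvex :: "('a::real_vector \<Rightarrow> ereal) \<Rightarrow> bool" where
  "econvex h \<longleftrightarrow> (\<forall>x y. \<forall>u\<ge>0. \<forall>v\<ge>0. u + v = 1 \<longrightarrow>
     h (u *\<^sub>R x + v *\<^sub>R y) \<le> ereal u * h x + ereal v * h y)"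

definition strongly_econvex :: "real \<Rightarrow> ('a::real_inner \<Rightarrow> ereal) \<Rightarrow> bool" where
  "strongly_econvex \<omega> h \<longleftrightarrow> (\<forall>x y. \<forall>u\<ge>0. \<forall>v\<ge>0. u + v = 1 \<longrightarrow>
     h (u *\<^sub>R x + v *\<^sub>R y) + ereal (\<omega> / 2 * u * v * (norm (x - y))\<^sup>2)
       \<le> ereal u * h x + ereal v * h y)"

definition conjugate :: "('a::real_inner \<Rightarrow> ereal) \<Rightarrow> 'a \<Rightarrow> ereal" where
  "conjugate h y = (SUP x. ereal (x \<bullet> y) - h x)"

definition subdifferential :: "('a::real_inner \<Rightarrow> ereal) \<Rightarrow> 'a \<Rightarrow> 'a set" where
  "subdifferential h x = {p. \<bar>h x\<bar> \<noteq> \<infinity> \<and> (\<forall>z. h x + ereal (p \<bullet> (z - x)) \<le> h z)}"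

text \<open>The resolvent \<open>(id + \<gamma> \<partial>h)\<^sup>-\<^sup>1\<close>, as a function: the unique \<open>p\<close> with \<open>z \<in> p + \<gamma> \<partial>h(p)\<close>.\<close>

definition prox :: "real \<Rightarrow> ('a::real_inner \<Rightarrow> ereal) \<Rightarrow> 'a \<Rightarrow> 'a" where
  "prox \<gamma> h z = (THE p. z \<in> (\<lambda>s. p + \<gamma> *\<^sub>R s) ` subdifferential h p)"

definition eexp :: "ereal \<Rightarrow> ennreal" where
  "eexp t = (if t = \<infinity> then \<top> else if t = -\<infinity> then 0 else ennreal (exp (real_of_ereal t)))"

section \<open>Measures with finite second moment and transport distances\<close>

definition P2 :: "'a::real_normed_vector measure set" where
  "P2 = {\<mu> \<in> space (prob_algebra borel). (\<integral>\<^sup>+ z. ennreal ((norm z)\<^sup>2) \<partial>\<mu>) < \<top>}"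

definition couplings ::
  "'a::topological_space measure \<Rightarrow> 'b::topological_space measure \<Rightarrow> ('a \<times> 'b) measure set" where
  "couplings \<mu> \<nu> =
     {\<gamma> \<in> space (prob_algebra borel). distr \<gamma> borel fst = \<mu> \<and> distr \<gamma> borel snd = \<nu>}"

definition esqrt :: "ennreal \<Rightarrow> ennreal" where
  "esqrt t = (if t = \<top> then \<top> else ennreal (sqrt (enn2real t)))"

definition wasserstein2 :: "'a::metric_space measure \<Rightarrow> 'a measure \<Rightarrow> ennreal" where
  "wasserstein2 \<mu> \<nu> =
     (INF \<gamma>\<in>couplings \<mu> \<nu>. esqrt (\<integral>\<^sup>+ (x, x'). ennreal ((dist x x')\<^sup>2) \<partial>\<gamma>))"

definition transport ::
  "real \<Rightarrow> real \<Rightarrow> ('a::real_normed_vector \<times> 'b::real_normed_vector) measure \<Rightarrow> ('a \<times> 'b) measure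
     \<Rightarrow> ennreal" where
  "transport a b \<pi> \<pi>' =
     (INF \<gamma>\<in>couplings \<pi> \<pi>'. esqrt (\<integral>\<^sup>+ ((x, y), (x', y')).
        ennreal (a * (norm (x - x'))\<^sup>2 + b * (norm (y - y'))\<^sup>2) \<partial>\<gamma>))"

section \<open>The primal-dual Langevin iteration\<close>

definition std_gaussian :: "(real^'d) measure" where
  "std_gaussian = density lborel (\<lambda>x. ennreal (\<Prod>i\<in>UNIV. std_normal_density (x $ i)))"

text \<open>One step maps the state \<open>(X\<^sup>n, X\<^sub>\<theta>\<^sup>n, Y\<^sup>n)\<close> and the input \<open>\<xi>\<^sup>n\<^sup>+\<^sup>1\<close> to the next state.\<close>

definition pd_step ::
  "(real^'d \<Rightarrow> real^'m) \<Rightarrow> (real^'m \<Rightarrow> ereal) \<Rightarrow> (real^'d \<Rightarrow> ereal) \<Rightarrow> real \<Rightarrow> real \<Rightarrow> real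
     \<Rightarrow> (real^'d) \<times> (real^'d) \<times> (real^'m) \<Rightarrow> real^'d \<Rightarrow> (real^'d) \<times> (real^'d) \<times> (real^'m)" where
  "pd_step K f g \<tau> \<sigma> \<theta> = (\<lambda>(x, x\<^sub>\<theta>, y) e.
     let y' = prox \<sigma> (conjugate f) (y + \<sigma> *\<^sub>R K x\<^sub>\<theta>);
         x' = prox \<tau> g (x - \<tau> *\<^sub>R adjoint K y') + sqrt (2 * \<tau>) *\<^sub>R e
     in (x', x' + \<theta> *\<^sub>R (x' - x), y'))"

definition pd_langevin ::
  "(real^'d \<Rightarrow> real^'m) \<Rightarrow> (real^'m \<Rightarrow> ereal) \<Rightarrow> (real^'d \<Rightarrow> ereal) \<Rightarrow> real \<Rightarrow> real \<Rightarrow> real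
     \<Rightarrow> 'w measure \<Rightarrow> (nat \<Rightarrow> 'w \<Rightarrow> real^'d) \<Rightarrow> ((real^'d) \<times> (real^'m)) measure
     \<Rightarrow> (nat \<Rightarrow> 'w \<Rightarrow> real^'d) \<Rightarrow> (nat \<Rightarrow> 'w \<Rightarrow> real^'d) \<Rightarrow> (nat \<Rightarrow> 'w \<Rightarrow> real^'m) \<Rightarrow> bool" where
  "pd_langevin K f g \<tau> \<sigma> \<theta> M \<xi> \<pi>\<^sub>0 X X\<^sub>\<theta> Y \<longleftrightarrow>
     X 0 \<in> borel_measurable M \<and> Y 0 \<in> borel_measurable M \<and>
     distr M borel (\<lambda>w. (X 0 w, Y 0 w)) = \<pi>\<^sub>0 \<and>
     (\<forall>w\<in>space M. X\<^sub>\<theta> 0 w = X 0 w) \<and>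
     (\<forall>n. \<forall>w\<in>space M. (X (Suc n) w, X\<^sub>\<theta> (Suc n) w, Y (Suc n) w)
        = pd_step K f g \<tau> \<sigma> \<theta> (X n w, X\<^sub>\<theta> n w, Y n w) (\<xi> (Suc n) w))"

text \<open>The inputs \<open>\<xi>\<^sup>1, \<xi>\<^sup>2, \<dots>\<close> (index \<open>0\<close> is unused) are i.i.d. standard Gaussian, and the
  whole sequence is independent of \<open>Z\<close>. Independence from \<open>Z\<close> is expressed through the generated
  sigma-algebras because \<open>indep_var\<close> wants both variables to have the same value type.\<close>

definition gaussian_inputs ::
  "'w measure \<Rightarrow> (nat \<Rightarrow> 'w \<Rightarrow> real^'d) \<Rightarrow> ('w \<Rightarrow> 'z::topological_space) \<Rightarrow> bool" where
  "gaussian_inputs M \<xi> Z \<longleftrightarrow>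
     prob_space.indep_vars M (\<lambda>_. borel) \<xi> {1..} \<and>
     (\<forall>n\<ge>1. distr M borel (\<xi> n) = std_gaussian) \<and>
     prob_space.indep_set M
       (sets (vimage_algebra (space M) Z borel))
       (sets (vimage_algebra (space M) (\<lambda>w. \<lambda>n\<in>{1..}. \<xi> n w) (Pi\<^sub>M {1..} (\<lambda>_. borel))))"

text \<open>For \<open>\<theta> \<noteq> 0\<close> the pair \<open>(X\<^sup>n, Y\<^sup>n)\<close> alone is not a Markov chain, whereas the full state
  \<open>(X\<^sup>n, X\<^sub>\<theta>\<^sup>n, Y\<^sup>n)\<close> is. A distribution of \<open>(X, Y)\<close> is called stationary if it is the
  \<open>(X, Y)\<close>-marginal of an invariant law of the full state.\<close>

definition pd_stationary ::
  "(real^'d \<Rightarrow> real^'m) \<Rightarrow> (real^'m \<Rightarrow> ereal) \<Rightarrow> (real^'d \<Rightarrow> ereal) \<Rightarrow> real \<Rightarrow> real \<Rightarrow> real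
     \<Rightarrow> ((real^'d) \<times> (real^'m)) measure \<Rightarrow> bool" where
  "pd_stationary K f g \<tau> \<sigma> \<theta> \<pi> \<longleftrightarrow>
     (\<exists>\<rho>\<in>space (prob_algebra borel).
        distr (\<rho> \<Otimes>\<^sub>M std_gaussian) borel (\<lambda>(s, e). pd_step K f g \<tau> \<sigma> \<theta> s e) = \<rho> \<and>
        distr \<rho> borel (\<lambda>(x, x\<^sub>\<theta>, y). (x, y)) = \<pi>)"

end

theory Submission
  imports Defs
begin

text \<open>Feed two copies of the chain with the same Gaussian inputs. The noise is additive, so it cancels in
the difference of the two states, and what remains is a deterministic question about the
primal-dual proximal step. Write \<open>a = 1 + 2\<omega>\<^sub>g\<tau>\<close>, \<open>b = 1 + 2\<omega>\<^sub>f\<sigma>\<close>, and let \<open>u = (x\<^sub>\<theta> - x) / \<theta>\<close> be the last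
primal increment that is stored in the full state \<open>(x, x\<^sub>\<theta>, y)\<close>. The quadratic form
\<open>V(x, x\<^sub>\<theta>, y) = a/\<tau> |x|\<^sup>2 + b/\<sigma> |y|\<^sup>2 + |u|\<^sup>2/\<tau> + 2 \<langle>K u, y\<rangle>\<close> of the difference shrinks by the factor \<open>\<theta>\<close> in each
step, for every value of the noise (\<open>pd_lyapunov_contraction\<close>): strong convexity of \<open>g\<close> and \<open>f\<^sup>*\<close>
makes the two proximal maps strongly monotone, and the extrapolation turns the bilinear terms into
a telescoping one, up to a product that \<open>\<theta>\<sigma>\<tau>L\<^sup>2 \<le> 1\<close> lets the squares absorb.

At time \<open>0\<close> there is no increment, and \<open>V\<close> is \<open>a/\<tau>\<close> times the cost
\<open>|x|\<^sup>2 + |y|\<^sup>2/\<lambda>'\<close>. At time \<open>N\<close>, the form \<open>V\<close> is at least \<open>a/\<tau> |x|\<^sup>2\<close>, and at least \<open>(1 - \<theta>\<sigma>\<tau>L\<^sup>2) a/\<tau>\<close> times that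
cost. These two lower bounds give the two inequalities, with the constants \<open>1\<close> and \<open>C\<close>.

The right-hand sides contain an infimum over all couplings of the initial laws, whereas the
initial values come with a coupling of their own. By independence, however, the law of the state at time \<open>N\<close>
is the \<open>N\<close>-fold image of the initial law under the Markov operator (\<open>distr_orbit\<close>,
\<open>gaussian_inputs_independent\<close>), and every coupling of two initial laws can be propagated by the synchronous
pair of steps (\<open>synchronous_coupling\<close>, \<open>synchronous_contraction\<close>).

For \<open>\<theta>\<sigma>\<tau>L\<^sup>2 < 1\<close> the form \<open>V\<close> is positive definite, so the step is a pathwise contraction of a Euclidean norm.
Composing the random steps in the reversed order, the newest innermost, gives random points whose
increments decay geometrically. They converge almost surely, and the law of the limit is invariant
and has a finite second moment (\<open>invariant_law_exists\<close>). Convergence to it is the contraction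
estimate once more, started from the independent coupling.\<close>

section \<open>Lower semicontinuous convex functions and their proximal maps\<close>

lemma lsc_open_superlevel:
  fixes h :: "'a::topological_space \<Rightarrow> ereal"
  assumes "lsc h" shows "open {x. c < h x}"
proof (subst open_subopen, safe)
  fix x assume x: "c < h x"
  also have "h x \<le> Liminf (at x) h" using assms by (simp add: lsc_def)
  finally have "\<forall>\<^sub>F y in at x. c < h y" by (rule less_LiminfD)
  then obtain T where "open T" "x \<in> T" "\<forall>y\<in>T. y \<noteq> x \<longrightarrow> c < h y"
    unfolding eventually_at_topological by blast
  with x show "\<exists>T. open T \<and> x \<in> T \<and> T \<subseteq> {x. c < h x}" by (intro exI[of _ T]) auto
qed

text \<open>If no point of \<open>S\<close> were minimal, the open sets on which \<open>h\<close> exceeds one of its values on \<open>S\<close> would cover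
\<open>S\<close>. In a finite subcover, the point that contributes the least value is covered by none of them.\<close>

lemma attains_Min_on_compact:
  fixes h :: "'a::topological_space \<Rightarrow> 'b::linorder"
  assumes op: "\<And>c. open {x. c < h x}" and S: "compact S" "S \<noteq> {}"
  shows "\<exists>x\<in>S. \<forall>y\<in>S. h x \<le> h y"
proof (rule ccontr)
  assume "\<not> ?thesis"
  then have "S \<subseteq> (\<Union>y\<in>S. {x. h y < h x})" by (fastforce simp: not_le)
  from compactE_image[OF S(1) _ this] op
  obtain F where F: "F \<subseteq> S" "finite F" "S \<subseteq> (\<Union>y\<in>F. {x. h y < h x})" by metis
  with S have "F \<noteq> {}" by auto
  with F obtain y where "y \<in> F" "\<forall>z\<in>F. h y \<le> h z"
    by (metis arg_min_if_finite(1) arg_min_least)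
  with F show False by (fastforce simp: not_less subset_iff)
qed

text \<open>A real number \<open>d\<close> strictly between \<open>c - q x\<close> and \<open>h x\<close> decouples the two summands: near \<open>x\<close> both
\<open>d < h\<close> and \<open>c < d + q\<close> persist.\<close>

lemma lsc_add_continuous_open_superlevel:
  fixes h :: "'a::topological_space \<Rightarrow> ereal"
  assumes "lsc h" "continuous_on UNIV q"
  shows "open {x. c < h x + ereal (q x)}"
proof (subst open_subopen, safe)
  fix x assume "c < h x + ereal (q x)"
  then have "c - ereal (q x) < h x" by (metis abs_ereal.simps(1) add.commute ereal_minus_less_iff ereal_minus_less PInfty_neq_ereal(1) MInfty_neq_ereal(1) ereal_minus_less_iff)
  then obtain d where d: "c - ereal (q x) < ereal d" "ereal d < h x"
    using ereal_dense2 by blast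
  let ?T = "{y. ereal d < h y} \<inter> {y. c < ereal (d + q y)}"
  have "open {y. c < ereal (d + q y)}"
    by (intro open_Collect_less continuous_intros continuous_on_ereal assms)
  then have "open ?T" using lsc_open_superlevel[OF assms(1)] by blast
  moreover have "x \<in> ?T" using d by (cases c) (auto simp: algebra_simps)
  moreover have "?T \<subseteq> {x. c < h x + ereal (q x)}"
  proof safe
    fix y assume "ereal d < h y" "c < ereal (d + q y)"
    then show "c < h y + ereal (q y)" by (cases c; cases "h y") auto
  qed
  ultimately show "\<exists>T. open T \<and> x \<in> T \<and> T \<subseteq> {x. c < h x + ereal (q x)}" by blast
qed

text \<open>Convexity is used below along short segments, which costs an error proportional to their relative
length \<open>t\<close>.\<close>

lemma le_of_le_add_small_multiple:
  fixes A B c :: real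
  assumes "\<And>t. 0 < t \<Longrightarrow> t < 1 \<Longrightarrow> A \<le> B + t * c"
  shows "A \<le> B"
proof -
  have "((\<lambda>t. B + t * c) \<longlongrightarrow> B + 0 * c) (at_right 0)" by (intro tendsto_intros)
  then have "A \<le> B + 0 * c"
    by (rule tendsto_lowerbound)
       (auto simp: eventually_at_right_field intro!: exI[of _ 1] assms)
  then show ?thesis by simp
qed

lemma econvexD_real:
  assumes "econvex h" "\<bar>h x\<bar> \<noteq> \<infinity>" "\<bar>h y\<bar> \<noteq> \<infinity>" "0 \<le> t" "t \<le> 1"
  shows "h (x + t *\<^sub>R (y - x)) \<le> ereal ((1 - t) * real_of_ereal (h x) + t * real_of_ereal (h y))"
proof -
  have eq: "x + t *\<^sub>R (y - x) = (1 - t) *\<^sub>R x + t *\<^sub>R y" by (simp add: algebra_simps)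
  have "h ((1 - t) *\<^sub>R x + t *\<^sub>R y) \<le> ereal (1 - t) * h x + ereal t * h y"
    using assms(1,4,5) by (auto simp: econvex_def)
  also have "\<dots> = ereal ((1 - t) * real_of_ereal (h x) + t * real_of_ereal (h y))"
    using assms(2,3) by (cases "h x"; cases "h y") auto
  finally show ?thesis unfolding eq .
qed

lemma strongly_econvex_imp_econvex:
  fixes h :: "'a::real_inner \<Rightarrow> ereal"
  assumes "0 \<le> \<omega>" "strongly_econvex \<omega> h" shows "econvex h"
  unfolding econvex_def
proof (intro allI impI)
  fix x y :: 'a and u v :: real assume uv: "0 \<le> u" "0 \<le> v" "u + v = 1"
  let ?e = "\<omega> / 2 * u * v * (norm (x - y))\<^sup>2"
  have "h (u *\<^sub>R x + v *\<^sub>R y) \<le> h (u *\<^sub>R x + v *\<^sub>R y) + ereal ?e"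
    using uv assms(1) by (intro add_increasing2) auto
  also have "\<dots> \<le> ereal u * h x + ereal v * h y"
    using uv assms(2) by (auto simp: strongly_econvex_def)
  finally show "h (u *\<^sub>R x + v *\<^sub>R y) \<le> ereal u * h x + ereal v * h y" .
qed

text \<open>On a ball around a point \<open>x0\<close> of the domain, \<open>h\<close> is bounded below by compactness. Convexity along the
rays from \<open>x0\<close> propagates this to a lower bound that is affine in the distance from \<open>x0\<close>. The quadratic
term dominates it, so outside a large ball every value exceeds the one at \<open>x0\<close>.\<close>

lemma econvex_lsc_quadratic_attains_Min:
  fixes h :: "'a::euclidean_space \<Rightarrow> ereal"
  assumes h: "lsc h" "econvex h" "\<And>x. h x \<noteq> -\<infinity>" "h x0 \<noteq> \<infinity>" and \<gamma>: "0 < \<gamma>"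
  shows "\<exists>p. \<bar>h p\<bar> \<noteq> \<infinity> \<and>
           (\<forall>x. h p + ereal ((norm (p - z))\<^sup>2 / (2 * \<gamma>)) \<le> h x + ereal ((norm (x - z))\<^sup>2 / (2 * \<gamma>)))"
proof -
  define \<phi> where "\<phi> x = h x + ereal ((norm (x - z))\<^sup>2 / (2 * \<gamma>))" for x
  have op: "open {x. c < \<phi> x}" for c
    unfolding \<phi>_def by (intro lsc_add_continuous_open_superlevel h continuous_intros) (use \<gamma> in auto)
  obtain x1 where x1: "x1 \<in> cball x0 1" "\<And>y. y \<in> cball x0 1 \<Longrightarrow> h x1 \<le> h y"
    using attains_Min_on_compact[of h "cball x0 1"] lsc_open_superlevel[OF h(1)] by auto
  obtain h0 where h0: "h x0 = ereal h0" using h(3)[of x0] h(4) by (cases "h x0") auto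
  have "h x1 \<le> h x0" by (rule x1) simp
  then obtain m where m: "h x1 = ereal m" using h(3)[of x1] h0 by (cases "h x1") auto
  define A where "A = h0 - m"
  have A0: "0 \<le> A" using \<open>h x1 \<le> h x0\<close> by (simp add: A_def h0 m)
  define d where "d = norm (x0 - z)"
  \<comment> \<open>With \<open>r = |x - x0|\<close>, the value at \<open>x\<close> exceeds the one at \<open>x0\<close> as soon as
    \<open>(r - d)\<^sup>2 - d\<^sup>2 > 2 \<gamma> A r\<close>; the affine lower bound for \<open>h\<close> holds for \<open>r \<ge> 1\<close>.\<close>
  define R where "R = max 1 (2 * d + 2 * \<gamma> * A)"
  have far: "\<phi> x0 < \<phi> x" if r: "R < norm (x - x0)" for x
  proof (cases "h x = \<infinity>")
    case True then show ?thesis by (simp add: \<phi>_def h0)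
  next
    case False
    then obtain hx where hx: "h x = ereal hx" using h(3)[of x] by (cases "h x") auto
    define r where "r = norm (x - x0)"
    have r1: "1 < r" "2 * d + 2 * \<gamma> * A < r" using r by (auto simp: R_def r_def)
    have "h (x0 + (1 / r) *\<^sub>R (x - x0)) \<le> ereal ((1 - 1 / r) * h0 + (1 / r) * hx)"
      using econvexD_real[OF h(2), of x0 x "1 / r"] r1 h0 hx by simp
    moreover have "x0 + (1 / r) *\<^sub>R (x - x0) \<in> cball x0 1"
      using r1 by (auto simp: dist_norm r_def)
    ultimately have "ereal m \<le> ereal ((1 - 1 / r) * h0 + (1 / r) * hx)"
      using x1(2) m by (metis order_trans)
    then have "r * m \<le> r * ((1 - 1 / r) * h0 + (1 / r) * hx)" using r1 by (intro mult_left_mono) auto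
    also have "\<dots> = (r - 1) * h0 + hx" using r1 by (simp add: field_simps)
    finally have lin: "h0 - r * A \<le> hx" by (simp add: A_def algebra_simps)
    have "r \<le> norm (x - z) + d"
      using norm_triangle_ineq4[of "x - z" "x0 - z"] by (simp add: r_def d_def)
    moreover have "0 \<le> r - d" using r1 A0 \<gamma> norm_ge_zero[of "x0 - z"] mult_nonneg_nonneg[of \<gamma> A]
      unfolding d_def[symmetric] by linarith
    ultimately have "(r - d)\<^sup>2 \<le> (norm (x - z))\<^sup>2" by (intro power_mono) auto
    moreover have "r * (2 * d + 2 * \<gamma> * A) < r * r" using r1 by (intro mult_strict_left_mono) auto
    ultimately have "2 * \<gamma> * (r * A) + d\<^sup>2 < (norm (x - z))\<^sup>2"
      by (simp add: power2_eq_square algebra_simps)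
    then have "(2 * \<gamma> * (r * A) + d\<^sup>2) / (2 * \<gamma>) < (norm (x - z))\<^sup>2 / (2 * \<gamma>)"
      using \<gamma> by (intro divide_strict_right_mono) auto
    then have "r * A + d\<^sup>2 / (2 * \<gamma>) < (norm (x - z))\<^sup>2 / (2 * \<gamma>)"
      using \<gamma> by (simp add: add_divide_distrib)
    then show ?thesis using lin by (simp add: \<phi>_def h0 hx d_def)
  qed
  have R0: "0 < R" by (simp add: R_def)
  obtain p where p: "p \<in> cball x0 R" "\<And>y. y \<in> cball x0 R \<Longrightarrow> \<phi> p \<le> \<phi> y"
    using attains_Min_on_compact[of \<phi> "cball x0 R"] op R0 by auto
  have min: "\<phi> p \<le> \<phi> x" for x
  proof (cases "norm (x - x0) \<le> R")
    case True then show ?thesis by (intro p) (simp add: dist_norm norm_minus_commute)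
  next
    case False
    then have "\<phi> x0 < \<phi> x" by (intro far) simp
    moreover have "\<phi> p \<le> \<phi> x0" using R0 by (intro p) simp
    ultimately show ?thesis by simp
  qed
  have "h p \<noteq> \<infinity>" using min[of x0] by (auto simp: \<phi>_def h0)
  then have "\<bar>h p\<bar> \<noteq> \<infinity>" using h(3)[of p] by (cases "h p") auto
  with min show ?thesis unfolding \<phi>_def by (intro exI[of _ p] conjI allI)
qed

text \<open>First-order optimality: comparing the minimiser \<open>p\<close> with \<open>p + t (x - p)\<close>, dividing by \<open>t\<close> and letting \<open>t\<close>
tend to \<open>0\<close> leaves the subgradient inequality for \<open>(z - p) / \<gamma>\<close>.\<close>

lemma resolvent_exists:
  fixes h :: "'a::euclidean_space \<Rightarrow> ereal"
  assumes h: "lsc h" "econvex h" "\<And>x. h x \<noteq> -\<infinity>" "h x0 \<noteq> \<infinity>" and \<gamma>: "0 < \<gamma>"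
  shows "\<exists>p. (1 / \<gamma>) *\<^sub>R (z - p) \<in> subdifferential h p"
proof -
  obtain p where fin: "\<bar>h p\<bar> \<noteq> \<infinity>" and
    min: "\<And>x. h p + ereal ((norm (p - z))\<^sup>2 / (2 * \<gamma>)) \<le> h x + ereal ((norm (x - z))\<^sup>2 / (2 * \<gamma>))"
    using econvex_lsc_quadratic_attains_Min[where ?x0.0 = x0 and z = z, OF assms] by metis
  obtain hp where hp: "h p = ereal hp" using fin by (cases "h p") auto
  have "h p + ereal (((1 / \<gamma>) *\<^sub>R (z - p)) \<bullet> (x - p)) \<le> h x" for x
  proof (cases "h x = \<infinity>")
    case True then show ?thesis by simp
  next
    case False
    then obtain hx where hx: "h x = ereal hx" using h(3)[of x] by (cases "h x") auto
    have "hp + ((1 / \<gamma>) *\<^sub>R (z - p)) \<bullet> (x - p) \<le> hx"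
    proof (rule le_of_le_add_small_multiple)
      fix t :: real assume t: "0 < t" "t < 1"
      let ?q = "p + t *\<^sub>R (x - p)"
      have "ereal (hp + (norm (p - z))\<^sup>2 / (2 * \<gamma>)) \<le> h ?q + ereal ((norm (?q - z))\<^sup>2 / (2 * \<gamma>))"
        using min[of ?q] hp by simp
      also have "\<dots> \<le> ereal ((1 - t) * hp + t * hx) + ereal ((norm (?q - z))\<^sup>2 / (2 * \<gamma>))"
        using econvexD_real[OF h(2), of p x t] t hp hx by (intro add_right_mono) simp
      finally have "hp + (norm (p - z))\<^sup>2 / (2 * \<gamma>)
          \<le> (1 - t) * hp + t * hx + (norm (?q - z))\<^sup>2 / (2 * \<gamma>)" by simp
      moreover have "(norm (?q - z))\<^sup>2 = (norm (p - z))\<^sup>2 - 2 * t * ((z - p) \<bullet> (x - p)) + t\<^sup>2 * (norm (x - p))\<^sup>2"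
        unfolding power2_norm_eq_inner
        by (simp add: inner_diff inner_add inner_commute algebra_simps power2_eq_square)
      then have "(norm (?q - z))\<^sup>2 / (2 * \<gamma>) = (norm (p - z))\<^sup>2 / (2 * \<gamma>)
          - t * ((z - p) \<bullet> (x - p) / \<gamma>) + t * (t * ((norm (x - p))\<^sup>2 / (2 * \<gamma>)))"
        using \<gamma> by (simp add: field_simps power2_eq_square)
      ultimately have "t * (hp + (z - p) \<bullet> (x - p) / \<gamma>) \<le> t * (hx + t * ((norm (x - p))\<^sup>2 / (2 * \<gamma>)))"
        by (simp add: algebra_simps)
      then show "hp + ((1 / \<gamma>) *\<^sub>R (z - p)) \<bullet> (x - p) \<le> hx + t * ((norm (x - p))\<^sup>2 / (2 * \<gamma>))"
        using t by simp
    qed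
    then show ?thesis by (simp add: hp hx)
  qed
  then have "(1 / \<gamma>) *\<^sub>R (z - p) \<in> subdifferential h p"
    using fin unfolding subdifferential_def by blast
  then show ?thesis by blast
qed

text \<open>Strong convexity improves the subgradient inequality at \<open>p\<close> by \<open>\<omega>/2 |x - p|\<^sup>2\<close>. Add the improved
inequalities at \<open>p\<close> and \<open>p'\<close>, each evaluated at the other point.\<close>

lemma subdifferential_strongly_monotone:
  fixes h :: "'a::real_inner \<Rightarrow> ereal"
  assumes sc: "strongly_econvex \<omega> h"
    and s: "s \<in> subdifferential h p" and s': "s' \<in> subdifferential h p'"
  shows "\<omega> * (norm (p - p'))\<^sup>2 \<le> (s - s') \<bullet> (p - p')"
proof -
  have growth: "real_of_ereal (h p) + s \<bullet> (x - p) + \<omega> / 2 * (norm (x - p))\<^sup>2 \<le> real_of_ereal (h x)"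
    if s: "s \<in> subdifferential h p" and x: "\<bar>h x\<bar> \<noteq> \<infinity>" for s p x
  proof (rule le_of_le_add_small_multiple)
    fix t :: real assume t: "0 < t" "t < 1"
    obtain hp where hp: "h p = ereal hp" using s by (cases "h p") (auto simp: subdifferential_def)
    obtain hx where hx: "h x = ereal hx" using x by (cases "h x") auto
    let ?q = "(1 - t) *\<^sub>R p + t *\<^sub>R x" and ?e = "\<omega> / 2 * (1 - t) * t * (norm (p - x))\<^sup>2"
    have "h p + ereal (s \<bullet> (?q - p)) + ereal ?e \<le> h ?q + ereal ?e"
      using s by (intro add_right_mono) (auto simp: subdifferential_def)
    also have "\<dots> \<le> ereal (1 - t) * h p + ereal t * h x"
      using sc t by (auto simp: strongly_econvex_def)
    finally have "hp + s \<bullet> (?q - p) + ?e \<le> (1 - t) * hp + t * hx" by (simp add: hp hx)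
    moreover have "?q - p = t *\<^sub>R (x - p)" by (simp add: algebra_simps)
    ultimately have "t * (hp + s \<bullet> (x - p) + \<omega> / 2 * (1 - t) * (norm (x - p))\<^sup>2) \<le> t * hx"
      by (simp add: algebra_simps norm_minus_commute)
    then have "hp + s \<bullet> (x - p) + \<omega> / 2 * (1 - t) * (norm (x - p))\<^sup>2 \<le> hx" using t by simp
    moreover have "\<omega> / 2 * (1 - t) * (norm (x - p))\<^sup>2
        = \<omega> / 2 * (norm (x - p))\<^sup>2 - t * (\<omega> / 2 * (norm (x - p))\<^sup>2)" by algebra
    ultimately show "real_of_ereal (h p) + s \<bullet> (x - p) + \<omega> / 2 * (norm (x - p))\<^sup>2
        \<le> real_of_ereal (h x) + t * (\<omega> / 2 * (norm (x - p))\<^sup>2)"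
      unfolding hp hx real_of_ereal.simps by linarith
  qed
  have "\<bar>h p\<bar> \<noteq> \<infinity>" "\<bar>h p'\<bar> \<noteq> \<infinity>" using s s' by (auto simp: subdifferential_def)
  from growth[OF s this(2)] growth[OF s' this(1)] show ?thesis
    by (simp add: inner_diff norm_minus_commute inner_commute)
qed

text \<open>The definite description in \<open>prox\<close> is justified: a resolvent point exists by minimisation, and it is unique because the
subdifferential is monotone.\<close>

lemma prox_resolvent:
  fixes h :: "'a::euclidean_space \<Rightarrow> ereal"
  assumes h: "lsc h" "strongly_econvex \<omega> h" "0 \<le> \<omega>" "\<And>x. h x \<noteq> -\<infinity>" "h x0 \<noteq> \<infinity>" and \<gamma>: "0 < \<gamma>"
  shows "(1 / \<gamma>) *\<^sub>R (z - prox \<gamma> h z) \<in> subdifferential h (prox \<gamma> h z)"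
proof -
  have iff: "z \<in> (\<lambda>s. p + \<gamma> *\<^sub>R s) ` subdifferential h p \<longleftrightarrow>
      (1 / \<gamma>) *\<^sub>R (z - p) \<in> subdifferential h p" for p
  proof
    assume "z \<in> (\<lambda>s. p + \<gamma> *\<^sub>R s) ` subdifferential h p"
    then show "(1 / \<gamma>) *\<^sub>R (z - p) \<in> subdifferential h p" using \<gamma> by auto
  next
    assume "(1 / \<gamma>) *\<^sub>R (z - p) \<in> subdifferential h p"
    then show "z \<in> (\<lambda>s. p + \<gamma> *\<^sub>R s) ` subdifferential h p"
      by (rule rev_image_eqI) (use \<gamma> in simp)
  qed
  have "\<exists>!p. (1 / \<gamma>) *\<^sub>R (z - p) \<in> subdifferential h p"
  proof (rule ex_ex1I)
    show "\<exists>p. (1 / \<gamma>) *\<^sub>R (z - p) \<in> subdifferential h p"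
      by (intro resolvent_exists[where ?x0.0 = x0] strongly_econvex_imp_econvex[OF h(3,2)] h \<gamma>)
  next
    fix p p' assume "(1 / \<gamma>) *\<^sub>R (z - p) \<in> subdifferential h p"
      "(1 / \<gamma>) *\<^sub>R (z - p') \<in> subdifferential h p'"
    from subdifferential_strongly_monotone[OF h(2) this]
    have "0 \<le> ((1 / \<gamma>) *\<^sub>R (z - p) - (1 / \<gamma>) *\<^sub>R (z - p')) \<bullet> (p - p')"
      using h(3) by (smt (verit) mult_nonneg_nonneg zero_le_power2)
    also have "\<dots> = - ((p - p') \<bullet> (p - p') / \<gamma>)"
      by (simp add: inner_diff algebra_simps add_divide_distrib diff_divide_distrib)
    finally have "(p - p') \<bullet> (p - p') \<le> 0" using \<gamma> by (simp add: field_simps)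
    then show "p = p'" by (simp add: inner_eq_zero_iff inner_ge_zero order_antisym_conv)
  qed
  from theI'[OF this] show ?thesis unfolding prox_def iff .
qed

text \<open>This is the form in which strong convexity enters the contraction estimate; \<open>\<omega> = 0\<close> is firm
nonexpansiveness.\<close>

lemma prox_strongly_monotone:
  fixes h :: "'a::euclidean_space \<Rightarrow> ereal"
  assumes h: "lsc h" "strongly_econvex \<omega> h" "0 \<le> \<omega>" "\<And>x. h x \<noteq> -\<infinity>" "h x0 \<noteq> \<infinity>" and \<gamma>: "0 < \<gamma>"
  defines "P \<equiv> prox \<gamma> h"
  shows "\<gamma> * \<omega> * (norm (P z - P z'))\<^sup>2 \<le> ((z - z') - (P z - P z')) \<bullet> (P z - P z')"
proof -
  note r = prox_resolvent[where ?x0.0 = x0, OF h \<gamma>, folded P_def]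
  have "\<omega> * (norm (P z - P z'))\<^sup>2 \<le> ((1/\<gamma>) *\<^sub>R (z - P z) - (1/\<gamma>) *\<^sub>R (z' - P z')) \<bullet> (P z - P z')"
    by (rule subdifferential_strongly_monotone[OF h(2) r r])
  also have "(1/\<gamma>) *\<^sub>R (z - P z) - (1/\<gamma>) *\<^sub>R (z' - P z') = (1/\<gamma>) *\<^sub>R ((z - z') - (P z - P z'))"
    by (simp add: algebra_simps)
  finally have "\<omega> * (norm (P z - P z'))\<^sup>2 \<le> (((z - z') - (P z - P z')) \<bullet> (P z - P z')) / \<gamma>" by simp
  then show ?thesis using \<gamma> by (simp only: pos_le_divide_eq) (simp add: mult_ac)
qed

lemma conjugate_not_MInf:
  assumes "\<bar>f x\<bar> \<noteq> \<infinity>" shows "conjugate f y \<noteq> -\<infinity>"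
proof -
  have "ereal (x \<bullet> y) - f x \<le> conjugate f y" unfolding conjugate_def by (rule SUP_upper) simp
  with assms show ?thesis by (cases "f x") auto
qed

text \<open>A supremum of continuous affine functions, except for the terms with \<open>f x = \<infinity>\<close>, which are constantly \<open>-\<infinity>\<close>.\<close>

lemma lsc_conjugate:
  fixes f :: "'a::euclidean_space \<Rightarrow> ereal"
  assumes "\<And>x. f x \<noteq> -\<infinity>"
  shows "lsc (conjugate f)"
  unfolding lsc_def
proof
  fix y
  have "ereal (x \<bullet> y) - f x \<le> Liminf (at y) (conjugate f)" for x
  proof (cases "f x = \<infinity>")
    case True then show ?thesis by simp
  next
    case False
    then obtain c where c: "f x = ereal c" using assms[of x] by (cases "f x") auto
    have "((\<lambda>y'. ereal (x \<bullet> y' - c)) \<longlongrightarrow> ereal (x \<bullet> y - c)) (at y)"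
      by (intro tendsto_intros)
    then have "ereal (x \<bullet> y - c) = Liminf (at y) (\<lambda>y'. ereal (x \<bullet> y' - c))"
      by (intro lim_imp_Liminf[symmetric]) auto
    also have "\<dots> \<le> Liminf (at y) (conjugate f)"
      unfolding conjugate_def by (intro Liminf_mono always_eventually allI SUP_upper2[of x]) (auto simp: c)
    finally show ?thesis by (simp add: c)
  qed
  then show "conjugate f y \<le> Liminf (at y) (conjugate f)"
    unfolding conjugate_def[of f y] by (intro SUP_least)
qed

text \<open>Resolving \<open>f\<close> at the point \<open>0\<close> yields some \<open>p\<close> with the subgradient \<open>-p\<close>. The resulting affine minorant
of \<open>f\<close> bounds the supremum that defines the conjugate at \<open>-p\<close>.\<close>

lemma conjugate_finite:
  fixes f :: "'a::euclidean_space \<Rightarrow> ereal"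
  assumes f: "lsc f" "econvex f" "\<And>x. f x \<noteq> -\<infinity>" "f x0 \<noteq> \<infinity>"
  shows "\<exists>y. conjugate f y \<noteq> \<infinity>"
proof -
  obtain p where p: "- p \<in> subdifferential f p"
    using resolvent_exists[OF assms, of 1 0] by auto
  obtain c where c: "f p = ereal c" using p by (cases "f p") (auto simp: subdifferential_def)
  have "ereal (x \<bullet> (- p)) - f x \<le> ereal (p \<bullet> (- p) - c)" for x
  proof -
    have "f p + ereal ((- p) \<bullet> (x - p)) \<le> f x" using p by (simp add: subdifferential_def)
    then show ?thesis using c by (cases "f x") (auto simp: inner_diff inner_commute)
  qed
  then have "conjugate f (- p) \<le> ereal (p \<bullet> (- p) - c)" unfolding conjugate_def by (intro SUP_least)
  then have "conjugate f (- p) \<noteq> \<infinity>" by (metis PInfty_neq_ereal(1) ereal_infty_less_eq(1))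
  then show ?thesis by blast
qed

section \<open>A Lyapunov function for the primal-dual step\<close>

text \<open>The argument stands for the difference of two states of the algorithm. Since the extrapolated point is
\<open>x + \<theta> u\<close> with the preceding primal increment \<open>u\<close>, that increment can be read off from the state.\<close>

definition pd_lyapunov ::
  "('a::euclidean_space \<Rightarrow> 'b::euclidean_space) \<Rightarrow> real \<Rightarrow> real \<Rightarrow> real \<Rightarrow> real \<Rightarrow> real \<Rightarrow> 'a \<times> 'a \<times> 'b \<Rightarrow> real" where
  "pd_lyapunov K a b \<tau> \<sigma> \<theta> = (\<lambda>(x, x\<^sub>\<theta>, y).
     let u = (1 / \<theta>) *\<^sub>R (x\<^sub>\<theta> - x)
     in a / \<tau> * (norm x)\<^sup>2 + b / \<sigma> * (norm y)\<^sup>2 + (norm u)\<^sup>2 / \<tau> + 2 * (K u \<bullet> y))"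

lemma pd_lyapunov_eq:
  assumes "u = (1 / \<theta>) *\<^sub>R (x\<^sub>\<theta> - x)"
  shows "pd_lyapunov K a b \<tau> \<sigma> \<theta> (x, x\<^sub>\<theta>, y)
      = a / \<tau> * (norm x)\<^sup>2 + b / \<sigma> * (norm y)\<^sup>2 + (norm u)\<^sup>2 / \<tau> + 2 * (K u \<bullet> y)"
  by (simp add: pd_lyapunov_def Let_def assms)

lemma inner_le_onorm:
  fixes K :: "'a::euclidean_space \<Rightarrow> 'b::euclidean_space"
  assumes "linear K" shows "\<bar>K u \<bullet> y\<bar> \<le> onorm K * norm u * norm y"
proof -
  have "\<bar>K u \<bullet> y\<bar> \<le> norm (K u) * norm y" by (rule Cauchy_Schwarz_ineq2)
  also have "\<dots> \<le> (onorm K * norm u) * norm y"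
    by (intro mult_right_mono onorm linear_conv_bounded_linear[THEN iffD1] assms) auto
  finally show ?thesis .
qed

text \<open>The hypothesis on \<open>k\<close> says that the quadratic form has a nonpositive discriminant.\<close>

lemma weighted_young:
  fixes p q r s k :: real
  assumes "0 \<le> r" "0 \<le> s" "k\<^sup>2 \<le> r * s"
  shows "2 * k * p * q \<le> r * p\<^sup>2 + s * q\<^sup>2"
proof (cases "r = 0")
  case True
  then have "k = 0" using assms(3) by simp
  with assms True show ?thesis by simp
next
  case False
  have "0 \<le> (r * p - k * q)\<^sup>2 + (r * s - k\<^sup>2) * q\<^sup>2" using assms by auto
  also have "\<dots> = r * (r * p\<^sup>2 + s * q\<^sup>2 - 2 * k * p * q)" by (simp add: power2_eq_square algebra_simps)
  finally show ?thesis using assms False by (simp add: zero_le_mult_iff)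
qed

lemma inner_young_onorm:
  fixes K :: "'a::euclidean_space \<Rightarrow> 'b::euclidean_space"
  assumes "linear K" "0 \<le> r" "0 \<le> s" "(onorm K)\<^sup>2 \<le> r * s"
  shows "2 * \<bar>K u \<bullet> y\<bar> \<le> r * (norm u)\<^sup>2 + s * (norm y)\<^sup>2"
  using inner_le_onorm[OF assms(1), of u y] weighted_young[OF assms(2-4), of "norm u" "norm y"] by simp

text \<open>Multiply the monotonicity inequalities by \<open>2/\<sigma>\<close> and \<open>2/\<tau>\<close>, rewrite the inner products by polarisation,
and add. The bilinear terms combine to
\<open>\<langle>K u', y'\<rangle> - \<theta> \<langle>K u, y\<rangle> - \<theta> \<langle>K u, y' - y\<rangle>\<close>: the first two belong to \<open>V\<close> at the new and at the old state, and the
last one is absorbed by \<open>|y' - y|\<^sup>2/\<sigma>\<close> and \<open>\<theta> |u|\<^sup>2/\<tau>\<close> because of \<open>\<theta>\<sigma>\<tau>L\<^sup>2 \<le> 1\<close>. Finally \<open>\<theta> a \<ge> 1\<close> and \<open>\<theta> b \<ge> 1\<close> compare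
the bare squares of the old state with \<open>\<theta> V\<close>.\<close>

lemma pd_lyapunov_contraction:
  fixes K :: "'a::euclidean_space \<Rightarrow> 'b::euclidean_space"
  assumes K: "linear K" and pos: "0 < \<tau>" "0 < \<sigma>" "0 < \<theta>"
    and \<theta>: "1 \<le> \<theta> * (1 + 2 * \<omega>\<^sub>g * \<tau>)" "1 \<le> \<theta> * (1 + 2 * \<omega>\<^sub>f * \<sigma>)" and step: "\<theta> * \<sigma> * \<tau> * (onorm K)\<^sup>2 \<le> 1"
    and y': "\<sigma> * \<omega>\<^sub>f * (norm y')\<^sup>2 \<le> ((y + \<sigma> *\<^sub>R K x\<^sub>\<theta>) - y') \<bullet> y'"
    and x': "\<tau> * \<omega>\<^sub>g * (norm x')\<^sup>2 \<le> ((x - \<tau> *\<^sub>R adjoint K y') - x') \<bullet> x'"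
  defines "V \<equiv> pd_lyapunov K (1 + 2 * \<omega>\<^sub>g * \<tau>) (1 + 2 * \<omega>\<^sub>f * \<sigma>) \<tau> \<sigma> \<theta>"
  shows "V (x', x' + \<theta> *\<^sub>R (x' - x), y') \<le> \<theta> * V (x, x\<^sub>\<theta>, y)"
proof -
  let ?a = "1 + 2 * \<omega>\<^sub>g * \<tau>" and ?b = "1 + 2 * \<omega>\<^sub>f * \<sigma>"
  define u where "u = (1 / \<theta>) *\<^sub>R (x\<^sub>\<theta> - x)"
  define u' where "u' = x' - x"
  have x\<theta>: "x\<^sub>\<theta> = x + \<theta> *\<^sub>R u" using pos by (simp add: u_def)
  note Klin = linear_add[OF K] linear_diff[OF K] linear_scale[OF K]
  have split_quotient: "(A * B + C - 2 * t * k) / t = A / t * B + C / t - 2 * k" if "0 < t" for A B C k t :: real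
    using that by (simp add: field_simps)
  have polar: "2 * ((p - q) \<bullet> q) = (norm p)\<^sup>2 - (norm q)\<^sup>2 - (norm (q - p))\<^sup>2" for p q :: "'c::real_inner"
    unfolding power2_norm_eq_inner by (simp add: inner_diff inner_commute)
  have "2 * (\<sigma> * \<omega>\<^sub>f * (norm y')\<^sup>2) \<le> 2 * ((y - y') \<bullet> y') + 2 * \<sigma> * (K x\<^sub>\<theta> \<bullet> y')"
    using y' by (simp add: inner_diff inner_add algebra_simps)
  then have "?b * (norm y')\<^sup>2 + (norm (y' - y))\<^sup>2 - 2 * \<sigma> * (K x\<^sub>\<theta> \<bullet> y') \<le> (norm y)\<^sup>2"
    unfolding polar by (simp add: algebra_simps)
  then have "(?b * (norm y')\<^sup>2 + (norm (y' - y))\<^sup>2 - 2 * \<sigma> * (K x\<^sub>\<theta> \<bullet> y')) / \<sigma> \<le> (norm y)\<^sup>2 / \<sigma>"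
    using pos by (intro divide_right_mono) auto
  then have 1: "?b / \<sigma> * (norm y')\<^sup>2 + (norm (y' - y))\<^sup>2 / \<sigma> - 2 * (K x\<^sub>\<theta> \<bullet> y') \<le> (norm y)\<^sup>2 / \<sigma>"
    unfolding split_quotient[OF pos(2)] .
  have "2 * (\<tau> * \<omega>\<^sub>g * (norm x')\<^sup>2) \<le> 2 * ((x - x') \<bullet> x') - 2 * \<tau> * (adjoint K y' \<bullet> x')"
    using x' by (simp add: inner_diff inner_add algebra_simps)
  also have "adjoint K y' \<bullet> x' = K x' \<bullet> y'" using adjoint_works[OF K] by (simp add: inner_commute)
  finally have "?a * (norm x')\<^sup>2 + (norm u')\<^sup>2 + 2 * \<tau> * (K x' \<bullet> y') \<le> (norm x)\<^sup>2"
    unfolding polar u'_def by (simp add: algebra_simps)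
  then have "(?a * (norm x')\<^sup>2 + (norm u')\<^sup>2 + 2 * \<tau> * (K x' \<bullet> y')) / \<tau> \<le> (norm x)\<^sup>2 / \<tau>"
    using pos by (intro divide_right_mono) auto
  then have 2: "?a / \<tau> * (norm x')\<^sup>2 + (norm u')\<^sup>2 / \<tau> + 2 * (K x' \<bullet> y') \<le> (norm x)\<^sup>2 / \<tau>"
    using split_quotient[OF pos(1), where k = "- (K x' \<bullet> y')"] by simp
  have "K x' \<bullet> y' - K x\<^sub>\<theta> \<bullet> y' = K u' \<bullet> y' - \<theta> * (K u \<bullet> y) - \<theta> * (K u \<bullet> (y' - y))"
    unfolding x\<theta> u'_def by (simp add: Klin inner_diff inner_add algebra_simps)
  moreover have "2 * \<bar>K u \<bullet> (y' - y)\<bar> \<le> (1 / \<tau>) * (norm u)\<^sup>2 + (1 / (\<theta> * \<sigma>)) * (norm (y' - y))\<^sup>2"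
    using pos step by (intro inner_young_onorm K) (auto simp: field_simps)
  then have "\<theta> * (2 * \<bar>K u \<bullet> (y' - y)\<bar>) \<le> \<theta> * ((1 / \<tau>) * (norm u)\<^sup>2 + (1 / (\<theta> * \<sigma>)) * (norm (y' - y))\<^sup>2)"
    using pos by (intro mult_left_mono) auto
  then have "2 * (\<theta> * \<bar>K u \<bullet> (y' - y)\<bar>) \<le> \<theta> * ((norm u)\<^sup>2 / \<tau>) + (norm (y' - y))\<^sup>2 / \<sigma>"
    using pos by (simp add: distrib_left)
  moreover have "\<theta> * (K u \<bullet> (y' - y)) \<le> \<theta> * \<bar>K u \<bullet> (y' - y)\<bar>" using pos by (intro mult_left_mono) auto
  ultimately have "?a / \<tau> * (norm x')\<^sup>2 + ?b / \<sigma> * (norm y')\<^sup>2 + (norm u')\<^sup>2 / \<tau> + 2 * (K u' \<bullet> y')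
      \<le> (norm x)\<^sup>2 / \<tau> + (norm y)\<^sup>2 / \<sigma> + \<theta> * ((norm u)\<^sup>2 / \<tau>) + 2 * (\<theta> * (K u \<bullet> y))"
    using 1 2 by linarith
  moreover have "(norm x)\<^sup>2 / \<tau> \<le> \<theta> * (?a / \<tau> * (norm x)\<^sup>2)"
    using mult_right_mono[OF \<theta>(1), of "(norm x)\<^sup>2 / \<tau>"] pos by (simp add: mult_ac)
  moreover have "(norm y)\<^sup>2 / \<sigma> \<le> \<theta> * (?b / \<sigma> * (norm y)\<^sup>2)"
    using mult_right_mono[OF \<theta>(2), of "(norm y)\<^sup>2 / \<sigma>"] pos by (simp add: mult_ac)
  moreover have "u' = (1 / \<theta>) *\<^sub>R (x' + \<theta> *\<^sub>R (x' - x) - x')" using pos by (simp add: u'_def)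
  note V' = pd_lyapunov_eq[OF this, of K ?a ?b \<tau> \<sigma> y']
  ultimately show ?thesis
    unfolding V_def V' pd_lyapunov_eq[OF u_def] unfolding distrib_left mult.left_commute[of \<theta> 2] by linarith
qed

text \<open>The cross term \<open>2 \<langle>K u, y\<rangle>\<close> can be charged in two ways: to all of \<open>|u|\<^sup>2/\<tau>\<close> and a share \<open>q\<close> of \<open>b/\<sigma> |y|\<^sup>2\<close>, or
to a share \<open>q\<close> of \<open>|u|\<^sup>2/\<tau>\<close> and all of \<open>b/\<sigma> |y|\<^sup>2\<close>.\<close>

lemma pd_lyapunov_lower:
  fixes K :: "'a::euclidean_space \<Rightarrow> 'b::euclidean_space"
  assumes K: "linear K" and pos: "0 < \<tau>" "0 < \<sigma>" "0 < \<theta>" and b: "1 \<le> \<theta> * b"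
  defines "q \<equiv> \<theta> * \<sigma> * \<tau> * (onorm K)\<^sup>2"
  shows pd_lyapunov_lower_dual:
      "a / \<tau> * (norm x)\<^sup>2 + (1 - q) * (b / \<sigma> * (norm y)\<^sup>2) \<le> pd_lyapunov K a b \<tau> \<sigma> \<theta> (x, x\<^sub>\<theta>, y)"
    and pd_lyapunov_lower_increment:
      "a / \<tau> * (norm x)\<^sup>2 + (1 - q) * ((norm ((1 / \<theta>) *\<^sub>R (x\<^sub>\<theta> - x)))\<^sup>2 / \<tau>)
         \<le> pd_lyapunov K a b \<tau> \<sigma> \<theta> (x, x\<^sub>\<theta>, y)"
proof -
  let ?L = "onorm K"
  define u where "u = (1 / \<theta>) *\<^sub>R (x\<^sub>\<theta> - x)"
  have V: "pd_lyapunov K a b \<tau> \<sigma> \<theta> (x, x\<^sub>\<theta>, y)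
      = a / \<tau> * (norm x)\<^sup>2 + b / \<sigma> * (norm y)\<^sup>2 + (norm u)\<^sup>2 / \<tau> + 2 * (K u \<bullet> y)"
    by (rule pd_lyapunov_eq[OF u_def])
  have q0: "0 \<le> q" using pos by (simp add: q_def)
  have Ku: "- \<bar>K u \<bullet> y\<bar> \<le> K u \<bullet> y" by linarith
  have "2 * \<bar>K u \<bullet> y\<bar> \<le> (1 / \<tau>) * (norm u)\<^sup>2 + (\<tau> * ?L\<^sup>2) * (norm y)\<^sup>2"
    using pos by (intro inner_young_onorm K) auto
  moreover have "(\<tau> * ?L\<^sup>2) * (norm y)\<^sup>2 \<le> q * (b / \<sigma> * (norm y)\<^sup>2)"
    using mult_right_mono[OF b, of "\<tau> * ?L\<^sup>2 * (norm y)\<^sup>2"] pos by (simp add: q_def mult_ac)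
  ultimately show "a / \<tau> * (norm x)\<^sup>2 + (1 - q) * (b / \<sigma> * (norm y)\<^sup>2) \<le> pd_lyapunov K a b \<tau> \<sigma> \<theta> (x, x\<^sub>\<theta>, y)"
    using Ku unfolding V left_diff_distrib[of 1 q] by simp
  have "2 * \<bar>K u \<bullet> y\<bar> \<le> (q / \<tau>) * (norm u)\<^sup>2 + (b / \<sigma>) * (norm y)\<^sup>2"
  proof (intro inner_young_onorm K)
    show "0 \<le> q / \<tau>" using pos q0 by simp
    have "0 < \<theta> * b" using b by simp
    then show "0 \<le> b / \<sigma>" using pos by (simp add: zero_less_mult_iff)
    show "?L\<^sup>2 \<le> q / \<tau> * (b / \<sigma>)"
      using mult_right_mono[OF b, of "?L\<^sup>2"] pos by (simp add: q_def mult_ac)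
  qed
  then show "a / \<tau> * (norm x)\<^sup>2 + (1 - q) * ((norm ((1 / \<theta>) *\<^sub>R (x\<^sub>\<theta> - x)))\<^sup>2 / \<tau>)
      \<le> pd_lyapunov K a b \<tau> \<sigma> \<theta> (x, x\<^sub>\<theta>, y)"
    using Ku unfolding V u_def[symmetric] left_diff_distrib[of 1 q] by simp
qed

text \<open>The average of the two lower bounds controls \<open>x\<close>, \<open>y\<close> and \<open>u\<close>, hence also \<open>x\<^sub>\<theta> = x + \<theta> u\<close>.\<close>

lemma pd_lyapunov_coercive:
  fixes K :: "'a::euclidean_space \<Rightarrow> 'b::euclidean_space"
  assumes K: "linear K" and pos: "0 < \<tau>" "0 < \<sigma>" "0 < \<theta>" and \<theta>: "1 \<le> \<theta> * a" "1 \<le> \<theta> * b" "\<theta> < 1"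
    and q: "\<theta> * \<sigma> * \<tau> * (onorm K)\<^sup>2 < 1"
  shows "\<exists>c>0. \<forall>s. c * (norm s)\<^sup>2 \<le> pd_lyapunov K a b \<tau> \<sigma> \<theta> s"
proof -
  define r where "r = 1 - \<theta> * \<sigma> * \<tau> * (onorm K)\<^sup>2"
  have r: "0 < r" "r \<le> 1" using q pos by (auto simp: r_def)
  have "0 < \<theta> * a" "0 < \<theta> * b" using \<theta> by auto
  then have ab: "0 < a" "0 < b" using pos by (auto simp: zero_less_mult_iff)
  define c where "c = min (a / \<tau> / 3) (min (r / \<tau> / 4) (r * (b / \<sigma>) / 2))"
  have c: "0 < c" "3 * c \<le> a / \<tau>" "4 * c \<le> r / \<tau>" "2 * c \<le> r * (b / \<sigma>)"
  proof -
    have p: "0 < a / \<tau>" "0 < r / \<tau>" "0 < r * (b / \<sigma>)" using ab pos r by auto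
    show "0 < c" using p unfolding c_def min_less_iff_conj by (simp only: zero_less_divide_iff zero_less_numeral simp_thms)
    have "c \<le> a / \<tau> / 3" "c \<le> r / \<tau> / 4" "c \<le> r * (b / \<sigma>) / 2"
      unfolding c_def by (rule min.cobounded1 min.coboundedI2 order_refl)+
    then show "3 * c \<le> a / \<tau>" "4 * c \<le> r / \<tau>" "2 * c \<le> r * (b / \<sigma>)"
      by (simp_all only: le_divide_eq_numeral1 mult.commute)
  qed
  have "c * (norm s)\<^sup>2 \<le> pd_lyapunov K a b \<tau> \<sigma> \<theta> s" for s
  proof -
    obtain x z y where s: "s = (x, z, y)" by (cases s)
    define u where "u = (1 / \<theta>) *\<^sub>R (z - x)"
    have z: "z = x + \<theta> *\<^sub>R u" using pos by (simp add: u_def)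
    have "norm z \<le> norm x + norm u"
    proof -
      have "norm z \<le> norm x + norm (\<theta> *\<^sub>R u)" unfolding z by (rule norm_triangle_ineq)
      moreover have "\<theta> * norm u \<le> 1 * norm u" using \<theta> by (intro mult_right_mono) auto
      ultimately show ?thesis using pos by simp
    qed
    then have "(norm z)\<^sup>2 \<le> (norm x + norm u)\<^sup>2" by (intro power_mono) auto
    also have "\<dots> \<le> 2 * (norm x)\<^sup>2 + 2 * (norm u)\<^sup>2"
      using zero_le_power2[of "norm x - norm u"] by (simp add: power2_eq_square algebra_simps)
    finally have "(norm s)\<^sup>2 \<le> 3 * (norm x)\<^sup>2 + 2 * (norm u)\<^sup>2 + (norm y)\<^sup>2"
      by (simp add: s norm_Pair)
    then have "c * (norm s)\<^sup>2 \<le> c * (3 * (norm x)\<^sup>2 + 2 * (norm u)\<^sup>2 + (norm y)\<^sup>2)"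
      using c by (intro mult_left_mono) auto
    moreover have "3 * c * (norm x)\<^sup>2 \<le> a / \<tau> * (norm x)\<^sup>2" "4 * c * (norm u)\<^sup>2 \<le> r / \<tau> * (norm u)\<^sup>2"
      "2 * c * (norm y)\<^sup>2 \<le> r * (b / \<sigma>) * (norm y)\<^sup>2"
      using c by (intro mult_right_mono; simp)+
    moreover note pd_lyapunov_lower[OF K pos \<theta>(2), where a = a and x = x and y = y and x\<^sub>\<theta> = z, folded r_def u_def s]
    ultimately show ?thesis by (simp add: algebra_simps)
  qed
  with c show ?thesis by blast
qed

lemma pd_lyapunov_bounded:
  fixes K :: "'a::euclidean_space \<Rightarrow> 'b::euclidean_space"
  assumes K: "linear K" and pos: "0 < \<tau>" "0 < \<sigma>" "0 < \<theta>" and ab: "0 \<le> a" "0 \<le> b"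
  shows "\<exists>C\<ge>0. \<forall>s. pd_lyapunov K a b \<tau> \<sigma> \<theta> s \<le> C * (norm s)\<^sup>2"
proof -
  let ?L = "onorm K"
  have L: "0 \<le> ?L" using K by (intro onorm_pos_le) (simp add: linear_conv_bounded_linear)
  define C where "C = a / \<tau> + b / \<sigma> + 4 / \<theta>\<^sup>2 / \<tau> + ?L * (4 / \<theta>\<^sup>2) + ?L"
  have "pd_lyapunov K a b \<tau> \<sigma> \<theta> s \<le> C * (norm s)\<^sup>2" for s
  proof -
    obtain x z y where s: "s = (x, z, y)" by (cases s)
    define u where "u = (1 / \<theta>) *\<^sub>R (z - x)"
    have n: "(norm s)\<^sup>2 = (norm x)\<^sup>2 + (norm z)\<^sup>2 + (norm y)\<^sup>2" by (simp add: s norm_Pair)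
    have x: "(norm x)\<^sup>2 \<le> (norm s)\<^sup>2" and y: "(norm y)\<^sup>2 \<le> (norm s)\<^sup>2" by (auto simp: n)
    have "(norm (z - x))\<^sup>2 \<le> (norm z + norm x)\<^sup>2" by (intro power_mono norm_triangle_ineq4) auto
    also have "\<dots> \<le> 2 * ((norm z)\<^sup>2 + (norm x)\<^sup>2)"
      using zero_le_power2[of "norm x - norm z"] by (simp add: power2_eq_square algebra_simps)
    also have "\<dots> \<le> 4 * (norm s)\<^sup>2" unfolding n using zero_le_power2[of "norm y"] zero_le_power2[of "norm z"] zero_le_power2[of "norm x"] unfolding distrib_left by linarith
    finally have u: "(norm u)\<^sup>2 \<le> 4 / \<theta>\<^sup>2 * (norm s)\<^sup>2"
      using pos by (simp add: u_def power_divide divide_right_mono)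
    have "2 * \<bar>K u \<bullet> y\<bar> \<le> ?L * (norm u)\<^sup>2 + ?L * (norm y)\<^sup>2"
      using L by (intro inner_young_onorm K) (auto simp: power2_eq_square)
    also have "\<dots> \<le> ?L * (4 / \<theta>\<^sup>2 * (norm s)\<^sup>2) + ?L * (norm s)\<^sup>2"
      using L u y by (intro add_mono mult_left_mono)
    finally have "2 * (K u \<bullet> y) \<le> ?L * (4 / \<theta>\<^sup>2 * (norm s)\<^sup>2) + ?L * (norm s)\<^sup>2" by linarith
    moreover have "a / \<tau> * (norm x)\<^sup>2 \<le> a / \<tau> * (norm s)\<^sup>2" "b / \<sigma> * (norm y)\<^sup>2 \<le> b / \<sigma> * (norm s)\<^sup>2"
      using ab pos x y by (auto intro!: mult_left_mono divide_right_mono)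
    moreover have "(norm u)\<^sup>2 / \<tau> \<le> 4 / \<theta>\<^sup>2 * (norm s)\<^sup>2 / \<tau>" using u pos by (intro divide_right_mono) auto
    moreover have "pd_lyapunov K a b \<tau> \<sigma> \<theta> s
        = a / \<tau> * (norm x)\<^sup>2 + b / \<sigma> * (norm y)\<^sup>2 + (norm u)\<^sup>2 / \<tau> + 2 * (K u \<bullet> y)"
      unfolding s by (rule pd_lyapunov_eq[OF u_def])
    moreover have "C * (norm s)\<^sup>2 = a / \<tau> * (norm s)\<^sup>2 + b / \<sigma> * (norm s)\<^sup>2 + 4 / \<theta>\<^sup>2 * (norm s)\<^sup>2 / \<tau>
        + ?L * (4 / \<theta>\<^sup>2 * (norm s)\<^sup>2) + ?L * (norm s)\<^sup>2"
      by (simp add: C_def distrib_right)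
    ultimately show ?thesis by linarith
  qed
  moreover have "0 \<le> C" using ab pos L by (simp add: C_def)
  ultimately show ?thesis by blast
qed

section \<open>Random maps and synchronous coupling\<close>

lemma measure_eqI_nn_integral:
  assumes sets: "sets M = sets N"
    and eq: "\<And>f. f \<in> borel_measurable N \<Longrightarrow> (\<integral>\<^sup>+x. f x \<partial>M) = (\<integral>\<^sup>+x. f x \<partial>N)"
  shows "M = N"
proof (rule measure_eqI[OF sets])
  fix A assume A: "A \<in> sets M"
  then have "emeasure M A = (\<integral>\<^sup>+x. indicator A x \<partial>M)" by simp
  also have "\<dots> = (\<integral>\<^sup>+x. indicator A x \<partial>N)" using A sets by (intro eq) simp
  also have "\<dots> = emeasure N A" using A sets by simp
  finally show "emeasure M A = emeasure N A" .
qed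

text \<open>The Markov operator, acting on laws, of the chain that replaces the state \<open>s\<close> by \<open>F s e\<close> with fresh noise \<open>e\<close>
of law \<open>G\<close>.\<close>

definition push :: "('s::topological_space \<Rightarrow> 'e \<Rightarrow> 's) \<Rightarrow> 'e measure \<Rightarrow> 's measure \<Rightarrow> 's measure" where
  "push F G \<rho> = distr (\<rho> \<Otimes>\<^sub>M G) borel (\<lambda>(s, e). F s e)"

locale random_map = prob_space G
  for F :: "'s::topological_space \<Rightarrow> 'e::topological_space \<Rightarrow> 's" and G :: "'e measure" +
  assumes sets_noise [measurable_cong, simp]: "sets G = sets borel"
    and F_measurable: "(\<lambda>(s, e). F s e) \<in> borel_measurable (borel \<Otimes>\<^sub>M borel)"
begin

lemma F_measurable' [measurable (raw)]:
  assumes [measurable]: "f \<in> borel_measurable M" "g \<in> borel_measurable M"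
  shows "(\<lambda>x. F (f x) (g x)) \<in> borel_measurable M"
  using measurable_compose[OF measurable_Pair[OF assms] F_measurable] by simp

lemma push_prob:
  assumes "\<rho> \<in> space (prob_algebra borel)" shows "push F G \<rho> \<in> space (prob_algebra borel)"
proof -
  have [measurable_cong]: "sets \<rho> = sets borel" and "prob_space \<rho>"
    using assms by (auto simp: space_prob_algebra)
  then have "prob_space (\<rho> \<Otimes>\<^sub>M G)" by (intro prob_space_pair prob_space_axioms)
  then have "prob_space (push F G \<rho>)"
    unfolding push_def by (rule prob_space.prob_space_distr) measurable
  then show ?thesis by (simp add: space_prob_algebra push_def)
qed

lemma push_iter_prob:
  "\<rho> \<in> space (prob_algebra borel) \<Longrightarrow> (push F G ^^ n) \<rho> \<in> space (prob_algebra borel)"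
  by (induction n) (auto intro: push_prob)

lemma sets_push_iter: "sets \<rho> = sets borel \<Longrightarrow> sets ((push F G ^^ n) \<rho>) = sets borel"
  by (cases n) (auto simp: push_def)

lemma nn_integral_push:
  assumes "sets \<rho> = sets borel" and [measurable]: "f \<in> borel_measurable borel"
  shows "(\<integral>\<^sup>+s. f s \<partial>push F G \<rho>) = (\<integral>\<^sup>+s. \<integral>\<^sup>+e. f (F s e) \<partial>G \<partial>\<rho>)"
proof -
  note [measurable_cong] = assms(1)
  have "(\<integral>\<^sup>+s. f s \<partial>push F G \<rho>) = (\<integral>\<^sup>+x. f (F (fst x) (snd x)) \<partial>(\<rho> \<Otimes>\<^sub>M G))"
    unfolding push_def by (subst nn_integral_distr) (auto simp: case_prod_beta)
  also have "\<dots> = (\<integral>\<^sup>+s. \<integral>\<^sup>+e. f (F s e) \<partial>G \<partial>\<rho>)"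
    by (subst nn_integral_fst[symmetric]) auto
  finally show ?thesis .
qed

end

text \<open>This makes the marginals of a coupled chain evolve by the original operator: take for \<open>h\<close> a projection of the
product.\<close>

lemma push_semiconjugate:
  assumes "random_map F G" "random_map F' G" and \<rho>: "sets \<rho> = sets borel"
    and h: "h \<in> borel_measurable borel" and comm: "\<And>s e. h (F s e) = F' (h s) e"
  shows "push F' G (distr \<rho> borel h) = distr (push F G \<rho>) borel h"
proof -
  interpret A: random_map F G by fact
  interpret B: random_map F' G by fact
  note [measurable_cong] = \<rho> and [measurable] = h
  show ?thesis
  proof (rule measure_eqI_nn_integral)
    fix f :: "_ \<Rightarrow> ennreal" assume "f \<in> borel_measurable (distr (push F G \<rho>) borel h)"
    then have [measurable]: "f \<in> borel_measurable borel" by simp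
    have [measurable]: "h \<in> borel_measurable (push F G \<rho>)" by (simp add: push_def)
    have "(\<integral>\<^sup>+ s. f s \<partial>push F' G (distr \<rho> borel h)) = (\<integral>\<^sup>+s. \<integral>\<^sup>+e. f (F' (h s) e) \<partial>G \<partial>\<rho>)"
      by (subst B.nn_integral_push) (auto simp: nn_integral_distr)
    also have "\<dots> = (\<integral>\<^sup>+s. f (h s) \<partial>push F G \<rho>)"
      using \<rho> by (subst A.nn_integral_push) (auto simp: comm)
    finally show "(\<integral>\<^sup>+ s. f s \<partial>push F' G (distr \<rho> borel h)) = (\<integral>\<^sup>+ s. f s \<partial>distr (push F G \<rho>) borel h)"
      by (simp add: nn_integral_distr)
  qed (simp add: push_def)
qed

lemma push_iter_semiconjugate:
  assumes "random_map F G" "random_map F' G" and \<rho>: "\<rho> \<in> space (prob_algebra borel)"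
    and h: "h \<in> borel_measurable borel" and comm: "\<And>s e. h (F s e) = F' (h s) e"
  shows "(push F' G ^^ n) (distr \<rho> borel h) = distr ((push F G ^^ n) \<rho>) borel h"
proof (induction n)
  case (Suc n)
  have "sets ((push F G ^^ n) \<rho>) = sets borel"
    using \<rho> by (intro random_map.sets_push_iter[OF assms(1)]) (simp add: space_prob_algebra)
  then have "push F' G (distr ((push F G ^^ n) \<rho>) borel h) = distr (push F G ((push F G ^^ n) \<rho>)) borel h"
    by (intro push_semiconjugate assms)
  then show ?case by (simp add: Suc)
qed simp

definition synchronous :: "('s \<Rightarrow> 'e \<Rightarrow> 's) \<Rightarrow> 's \<times> 's \<Rightarrow> 'e \<Rightarrow> 's \<times> 's" where
  "synchronous F = (\<lambda>(s, s') e. (F s e, F s' e))"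

text \<open>The contraction holds for each value of the noise, so it survives integration over an arbitrary joint law of the
two states.\<close>

locale contractive_random_map = random_map F G
  for F :: "'s::euclidean_space \<Rightarrow> 'e::second_countable_topology \<Rightarrow> 's" and G :: "'e measure" +
  fixes V :: "'s \<Rightarrow> real" and \<theta> :: real
  assumes V_measurable [measurable]: "V \<in> borel_measurable borel"
    and V_contraction: "V (F s e - F s' e) \<le> \<theta> * V (s - s')"
    and \<theta>_nonneg: "0 \<le> \<theta>"
begin

lemma random_map_synchronous: "random_map (synchronous F) G"
proof
  have "(\<lambda>p. (F (fst (fst p)) (snd p), F (snd (fst p)) (snd p))) \<in>
      (borel :: ('s \<times> 's) measure) \<Otimes>\<^sub>M (borel :: 'e measure) \<rightarrow>\<^sub>M (borel :: 's measure) \<Otimes>\<^sub>M (borel :: 's measure)"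
    unfolding borel_prod[symmetric] by measurable
  then show "(\<lambda>(s, e). synchronous F s e) \<in> borel_measurable (borel \<Otimes>\<^sub>M borel)"
    by (simp add: borel_prod synchronous_def case_prod_beta)
qed simp

lemma synchronous_coupling:
  assumes \<Gamma>: "\<Gamma> \<in> couplings \<rho> \<rho>'"
  shows "(push (synchronous F) G ^^ n) \<Gamma> \<in> couplings ((push F G ^^ n) \<rho>) ((push F G ^^ n) \<rho>')"
proof -
  have p: "\<Gamma> \<in> space (prob_algebra borel)" "distr \<Gamma> borel fst = \<rho>" "distr \<Gamma> borel snd = \<rho>'"
    using \<Gamma> by (auto simp: couplings_def)
  have [measurable]: "fst \<in> borel_measurable (borel :: ('s \<times> 's) measure)" "snd \<in> borel_measurable (borel :: ('s \<times> 's) measure)"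
    unfolding borel_prod[symmetric] by measurable
  have "distr ((push (synchronous F) G ^^ n) \<Gamma>) borel fst = (push F G ^^ n) \<rho>"
    "distr ((push (synchronous F) G ^^ n) \<Gamma>) borel snd = (push F G ^^ n) \<rho>'"
    unfolding p(2,3)[symmetric]
    by (intro push_iter_semiconjugate[symmetric] random_map_synchronous random_map_axioms p(1); simp add: synchronous_def case_prod_beta)+
  then show ?thesis
    using random_map.push_iter_prob[OF random_map_synchronous p(1)] by (simp add: couplings_def)
qed

lemma synchronous_contraction:
  assumes \<Gamma>: "\<Gamma> \<in> space (prob_algebra borel)"
  shows "(\<integral>\<^sup>+(s, s'). ennreal (V (s - s')) \<partial>(push (synchronous F) G ^^ n) \<Gamma>)
      \<le> ennreal (\<theta> ^ n) * (\<integral>\<^sup>+(s, s'). ennreal (V (s - s')) \<partial>\<Gamma>)"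
proof (induction n)
  case (Suc n)
  let ?\<Gamma> = "(push (synchronous F) G ^^ n) \<Gamma>"
  define W :: "'s \<times> 's \<Rightarrow> ennreal" where "W = (\<lambda>(s, s'). ennreal (V (s - s')))"
  have sets: "sets ?\<Gamma> = sets borel"
    using \<Gamma> by (intro random_map.sets_push_iter[OF random_map_synchronous]) (simp add: space_prob_algebra)
  have W: "W \<in> borel_measurable borel"
    unfolding W_def borel_prod[symmetric] by measurable
  then have W': "W \<in> borel_measurable ?\<Gamma>" using sets by (simp cong: measurable_cong_sets)
  have step: "W (synchronous F p e) \<le> ennreal \<theta> * W p" for p e
    by (cases p)
       (auto simp: W_def synchronous_def ennreal_mult'[OF \<theta>_nonneg, symmetric] intro!: ennreal_leI V_contraction)
  have "(\<integral>\<^sup>+p. W p \<partial>push (synchronous F) G ?\<Gamma>) = (\<integral>\<^sup>+p. \<integral>\<^sup>+e. W (synchronous F p e) \<partial>G \<partial>?\<Gamma>)"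
    by (rule random_map.nn_integral_push[OF random_map_synchronous sets W])
  also have "\<dots> \<le> (\<integral>\<^sup>+p. \<integral>\<^sup>+e. ennreal \<theta> * W p \<partial>G \<partial>?\<Gamma>)"
    by (intro nn_integral_mono step)
  also have "\<dots> = (\<integral>\<^sup>+p. ennreal \<theta> * W p \<partial>?\<Gamma>)"
    by (simp add: emeasure_space_1)
  also have "\<dots> = ennreal \<theta> * (\<integral>\<^sup>+p. W p \<partial>?\<Gamma>)"
    by (rule nn_integral_cmult[OF W'])
  also have "\<dots> \<le> ennreal \<theta> * (ennreal (\<theta> ^ n) * (\<integral>\<^sup>+p. W p \<partial>\<Gamma>))"
    using Suc by (intro mult_left_mono) (auto simp: W_def)
  finally show ?case using \<theta>_nonneg by (simp add: ennreal_mult mult.assoc W_def)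
qed simp

end

section \<open>Invariant laws by backward iteration\<close>

text \<open>Composing the steps in the reversed order, with the newest input innermost, does not change the law of each iterate,
but makes the sequence of iterates converge: two consecutive ones differ only in what happens before \<open>n\<close> common
contractions.\<close>

context contractive_random_map
begin

primrec backward :: "nat \<Rightarrow> 'e stream \<Rightarrow> 's" where
  "backward 0 \<omega> = 0"
| "backward (Suc n) \<omega> = F (backward n (stl \<omega>)) (shd \<omega>)"

lemma backward_measurable [measurable]: "backward n \<in> borel_measurable (stream_space G)"
proof (induction n)
  case (Suc n)
  note [measurable] = Suc
  have [measurable]: "shd \<in> borel_measurable (stream_space G)"
    using measurable_shd[of G] by (simp cong: measurable_cong_sets)
  show ?case by simp
qed (simp cong: measurable_cong)

lemma backward_increment:
  "V (backward (Suc n) \<omega> - backward n \<omega>) \<le> \<theta> ^ n * V (F 0 (\<omega> !! n))"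
proof (induction n arbitrary: \<omega>)
  case (Suc n)
  have "V (backward (Suc (Suc n)) \<omega> - backward (Suc n) \<omega>)
      \<le> \<theta> * V (backward (Suc n) (stl \<omega>) - backward n (stl \<omega>))"
    unfolding backward.simps(2)[of _ \<omega>] by (rule V_contraction)
  also have "\<dots> \<le> \<theta> * (\<theta> ^ n * V (F 0 (stl \<omega> !! n)))"
    by (intro mult_left_mono Suc \<theta>_nonneg)
  finally show ?case by (simp add: mult.assoc)
qed simp

lemma nn_integral_snth:
  assumes [measurable]: "f \<in> borel_measurable G"
  shows "(\<integral>\<^sup>+\<omega>. f (\<omega> !! n) \<partial>stream_space G) = (\<integral>\<^sup>+e. f e \<partial>G)"
proof (induction n)
  case 0
  interpret S: prob_space "stream_space G" by (rule prob_space_stream_space)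
  show ?case by (subst nn_integral_stream_space) (auto simp: S.emeasure_space_1)
next
  case (Suc n)
  then show ?case by (subst nn_integral_stream_space) (auto simp: emeasure_space_1)
qed

text \<open>By \<open>backward_increment\<close>, the \<open>n\<close>-th increment is at most \<open>\<kappa> r\<^sup>n\<close> times the displacement of \<open>0\<close> by the \<open>n\<close>-th
input, where \<open>r\<^sup>2 = \<theta>\<close>. The weighted sum \<open>H\<close> of the squared displacements has a finite integral, so almost surely the
iterates converge to some \<open>B\<close>, and \<open>|B|\<^sup>2\<close> is at most a multiple of \<open>H\<close>. Since \<open>B\<close> of a stream is the image under \<open>F\<close> of
\<open>B\<close> of its tail, which is independent of the head, the law of \<open>B\<close> is invariant.\<close>

lemma invariant_law_exists:
  assumes \<theta>: "\<theta> < 1" and c: "0 < c" "\<And>s. c * (norm s)\<^sup>2 \<le> V s"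
    and C: "0 \<le> C" "\<And>s. V s \<le> C * (norm s)\<^sup>2"
    and cont: "\<And>e. continuous_on UNIV (\<lambda>s. F s e)"
    and moment: "(\<integral>\<^sup>+e. ennreal ((norm (F 0 e))\<^sup>2) \<partial>G) < \<top>"
  shows "\<exists>\<rho>\<in>P2. push F G \<rho> = \<rho>"
proof -
  interpret S: prob_space "stream_space G" by (rule prob_space_stream_space)
  define r where "r = sqrt \<theta>"
  have r: "0 \<le> r" "r < 1" "r\<^sup>2 = \<theta>" using \<theta> \<theta>_nonneg by (auto simp: r_def)
  define D where "D e = (norm (F 0 e))\<^sup>2" for e
  have D0: "0 \<le> D e" for e by (simp add: D_def)
  have "(\<lambda>e. F 0 e) \<in> borel_measurable borel" by measurable
  then have [measurable]: "(\<lambda>e. F 0 e) \<in> borel_measurable G" by (simp cong: measurable_cong_sets)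
  have [measurable]: "D \<in> borel_measurable G" unfolding D_def by measurable
  define H where "H \<omega> = (\<Sum>n. ennreal (r ^ n * D (\<omega> !! n)))" for \<omega>
  have [measurable]: "H \<in> borel_measurable (stream_space G)" unfolding H_def by measurable
  have "(\<integral>\<^sup>+\<omega>. H \<omega> \<partial>stream_space G) = (\<Sum>n. \<integral>\<^sup>+\<omega>. ennreal (r ^ n * D (\<omega> !! n)) \<partial>stream_space G)"
    unfolding H_def by (rule nn_integral_suminf) measurable
  also have "\<dots> = (\<Sum>n. (\<integral>\<^sup>+e. ennreal (D e) \<partial>G) * ennreal (r ^ n))"
    using r D0 by (intro suminf_cong, subst nn_integral_snth)
      (auto simp: ennreal_mult nn_integral_cmult mult.commute[of "integral\<^sup>N G _"])
  also have "\<dots> = (\<integral>\<^sup>+e. ennreal (D e) \<partial>G) * ennreal (\<Sum>n. r ^ n)"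
    using r by (simp add: suminf_ennreal2 summable_geometric)
  finally have H_fin: "(\<integral>\<^sup>+\<omega>. H \<omega> \<partial>stream_space G) < \<top>"
    using moment by (simp add: D_def ennreal_mult_less_top)
  then have good: "AE \<omega> in stream_space G. H \<omega> \<noteq> \<infinity>"
    by (intro nn_integral_noteq_infinite) auto

  define \<kappa> where "\<kappa> = sqrt (C / c)"
  have \<kappa>: "0 \<le> \<kappa>" using C c by (simp add: \<kappa>_def)
  let ?\<Delta> = "\<lambda>\<omega> n. backward (Suc n) \<omega> - backward n \<omega>"
  have inc: "norm (?\<Delta> \<omega> n) \<le> \<kappa> * (r ^ n * sqrt (D (\<omega> !! n)))" for \<omega> n
  proof -
    have "c * (norm (?\<Delta> \<omega> n))\<^sup>2 \<le> \<theta> ^ n * V (F 0 (\<omega> !! n))"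
      by (rule order_trans[OF c(2) backward_increment])
    also have "\<dots> \<le> \<theta> ^ n * (C * D (\<omega> !! n))"
      unfolding D_def by (intro mult_left_mono C) (simp add: \<theta>_nonneg)
    finally have "(norm (?\<Delta> \<omega> n))\<^sup>2 \<le> (C / c) * (\<theta> ^ n * D (\<omega> !! n))"
      using c by (simp add: field_simps)
    then have "norm (?\<Delta> \<omega> n) \<le> sqrt ((C / c) * (\<theta> ^ n * D (\<omega> !! n)))"
      by (rule real_le_rsqrt)
    then show ?thesis by (simp only: real_sqrt_mult real_sqrt_power \<kappa>_def r_def)
  qed
  have telescope: "backward n \<omega> = (\<Sum>k<n. ?\<Delta> \<omega> k)" for n \<omega>
    using sum_lessThan_telescope[of "\<lambda>k. backward k \<omega>" n] by simp
  have conv: "convergent (\<lambda>n. backward n \<omega>)"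
    and second: "ennreal ((norm (lim (\<lambda>n. backward n \<omega>)))\<^sup>2) \<le> ennreal (\<kappa>\<^sup>2 / (1 - r)) * H \<omega>"
    if "H \<omega> \<noteq> \<infinity>" for \<omega>
  proof -
    have sD: "summable (\<lambda>n. r ^ n * D (\<omega> !! n))"
      using that r D0 by (intro summable_suminf_not_top) (auto simp: H_def)
    have "summable (\<lambda>n. \<kappa> * (r ^ n + r ^ n * D (\<omega> !! n)))"
      using r by (intro summable_mult summable_add sD summable_geometric) auto
    moreover have "norm (?\<Delta> \<omega> n) \<le> \<kappa> * (r ^ n + r ^ n * D (\<omega> !! n))" for n
    proof -
      \<comment> \<open>The displacement is traded for its square, whose weighted sum is finite; the geometric
        series pays for the constant.\<close>
      have "sqrt x \<le> 1 + x" if "0 \<le> x" for x :: real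
        using that by (intro real_le_lsqrt) (auto simp: power2_eq_square algebra_simps)
      from this[OF D0] have "r ^ n * sqrt (D (\<omega> !! n)) \<le> r ^ n * (1 + D (\<omega> !! n))"
        using r by (intro mult_left_mono) auto
      then have "\<kappa> * (r ^ n * sqrt (D (\<omega> !! n))) \<le> \<kappa> * (r ^ n * (1 + D (\<omega> !! n)))"
        by (rule mult_left_mono[OF _ \<kappa>])
      then show ?thesis using inc[of n \<omega>] by (simp add: distrib_left)
    qed
    ultimately have "summable (?\<Delta> \<omega>)" by (rule summable_comparison_test'[where N = 0])
    then show conv: "convergent (\<lambda>n. backward n \<omega>)"
      unfolding summable_iff_convergent by (subst telescope)
    have bound: "(norm (backward n \<omega>))\<^sup>2 \<le> \<kappa>\<^sup>2 / (1 - r) * (\<Sum>n. r ^ n * D (\<omega> !! n))" for n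
    proof -
      \<comment> \<open>Splitting \<open>r\<^sup>k\<close> evenly between the two factors of Cauchy-Schwarz leaves one factor \<open>r\<^sup>k\<close> in
        each of the two sums.\<close>
      have "norm (backward n \<omega>) \<le> (\<Sum>k<n. \<kappa> * (r ^ k * sqrt (D (\<omega> !! k))))"
        by (subst telescope) (intro sum_norm_le inc)
      also have "\<dots> = \<kappa> * (\<Sum>k<n. sqrt (r ^ k) * sqrt (r ^ k * D (\<omega> !! k)))"
        using r by (simp add: sum_distrib_left real_sqrt_mult mult.assoc[symmetric])
      finally have "(norm (backward n \<omega>))\<^sup>2 \<le> (\<kappa> * (\<Sum>k<n. sqrt (r ^ k) * sqrt (r ^ k * D (\<omega> !! k))))\<^sup>2"
        by (intro power_mono) auto
      also have "\<dots> \<le> \<kappa>\<^sup>2 * ((\<Sum>k<n. (sqrt (r ^ k))\<^sup>2) * (\<Sum>k<n. (sqrt (r ^ k * D (\<omega> !! k)))\<^sup>2))"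
        unfolding power_mult_distrib[of \<kappa>] by (intro mult_left_mono Cauchy_Schwarz_ineq_sum) auto
      also have "\<dots> = \<kappa>\<^sup>2 * ((\<Sum>k<n. r ^ k) * (\<Sum>k<n. r ^ k * D (\<omega> !! k)))"
        using r D0 by simp
      also have "\<dots> \<le> \<kappa>\<^sup>2 * ((1 / (1 - r)) * (\<Sum>n. r ^ n * D (\<omega> !! n)))"
      proof (intro mult_left_mono mult_mono)
        show "(\<Sum>k<n. r ^ k) \<le> 1 / (1 - r)"
          using sum_le_suminf[of "\<lambda>k. r ^ k" "{..<n}"] r by (simp add: suminf_geometric summable_geometric)
        show "(\<Sum>k<n. r ^ k * D (\<omega> !! k)) \<le> (\<Sum>n. r ^ n * D (\<omega> !! n))"
          using r D0 by (intro sum_le_suminf sD) auto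
      qed (use r D0 in \<open>auto intro!: sum_nonneg\<close>)
      finally show ?thesis by simp
    qed
    have "(\<lambda>n. (norm (backward n \<omega>))\<^sup>2) \<longlonglongrightarrow> (norm (lim (\<lambda>n. backward n \<omega>)))\<^sup>2"
      using conv by (intro tendsto_intros) (simp add: convergent_LIMSEQ_iff)
    then have "(norm (lim (\<lambda>n. backward n \<omega>)))\<^sup>2 \<le> \<kappa>\<^sup>2 / (1 - r) * (\<Sum>n. r ^ n * D (\<omega> !! n))"
      by (rule LIMSEQ_le_const2) (use bound in blast)
    then have "ennreal ((norm (lim (\<lambda>n. backward n \<omega>)))\<^sup>2)
        \<le> ennreal (\<kappa>\<^sup>2 / (1 - r) * (\<Sum>n. r ^ n * D (\<omega> !! n)))" by (rule ennreal_leI)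
    also have "\<dots> = ennreal (\<kappa>\<^sup>2 / (1 - r)) * H \<omega>"
    proof -
      have "H \<omega> = ennreal (\<Sum>n. r ^ n * D (\<omega> !! n))"
        unfolding H_def using r D0 sD by (intro suminf_ennreal2) auto
      moreover have "0 \<le> (\<Sum>n. r ^ n * D (\<omega> !! n))" using r D0 by (intro suminf_nonneg sD) auto
      ultimately show ?thesis using r by (simp add: ennreal_mult[symmetric])
    qed
    finally show "ennreal ((norm (lim (\<lambda>n. backward n \<omega>)))\<^sup>2) \<le> ennreal (\<kappa>\<^sup>2 / (1 - r)) * H \<omega>" .
  qed

  define B where "B \<omega> = lim (\<lambda>n. backward n \<omega>)" for \<omega>
  have B [measurable]: "B \<in> borel_measurable (stream_space G)" unfolding B_def by measurable
  define \<rho> where "\<rho> = distr (stream_space G) borel B"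
  have \<rho>: "\<rho> \<in> space (prob_algebra borel)"
    unfolding \<rho>_def by (auto simp: space_prob_algebra intro!: S.prob_space_distr)
  have "(\<integral>\<^sup>+s. ennreal ((norm s)\<^sup>2) \<partial>\<rho>) = (\<integral>\<^sup>+\<omega>. ennreal ((norm (B \<omega>))\<^sup>2) \<partial>stream_space G)"
    unfolding \<rho>_def by (subst nn_integral_distr) auto
  also have "\<dots> \<le> (\<integral>\<^sup>+\<omega>. ennreal (\<kappa>\<^sup>2 / (1 - r)) * H \<omega> \<partial>stream_space G)"
    using good by (intro nn_integral_mono_AE) (auto simp: B_def intro!: second)
  also have "\<dots> = ennreal (\<kappa>\<^sup>2 / (1 - r)) * (\<integral>\<^sup>+\<omega>. H \<omega> \<partial>stream_space G)"
    by (rule nn_integral_cmult) measurable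
  also have "\<dots> < \<top>" using H_fin by (simp add: ennreal_mult_less_top)
  finally have "\<rho> \<in> P2" using \<rho> by (simp add: P2_def)
  moreover have "push F G \<rho> = \<rho>"
  proof (rule measure_eqI_nn_integral)
    fix f :: "'s \<Rightarrow> ennreal" assume "f \<in> borel_measurable \<rho>"
    then have f [measurable]: "f \<in> borel_measurable borel" by (simp add: \<rho>_def)
    \<comment> \<open>Fixing the stream and prepending \<open>e\<close>, instead of taking the tail of a given stream, keeps the
      exceptional null set one of the stream alone.\<close>
    have fixpoint: "B (e ## \<omega>) = F (B \<omega>) e" if "H \<omega> \<noteq> \<infinity>" for e \<omega>
    proof -
      have "(\<lambda>n. backward n \<omega>) \<longlonglongrightarrow> B \<omega>"
        using conv[OF that] by (simp add: B_def convergent_LIMSEQ_iff)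
      then have "(\<lambda>n. F (backward n \<omega>) e) \<longlonglongrightarrow> F (B \<omega>) e"
        by (rule continuous_on_tendsto_compose[OF cont]) auto
      then have "(\<lambda>n. backward (Suc n) (e ## \<omega>)) \<longlonglongrightarrow> F (B \<omega>) e" by simp
      then show ?thesis unfolding B_def by (intro limI) (rule LIMSEQ_imp_Suc)
    qed
    have swap: "(\<lambda>p. f (F (B (snd p)) (fst p))) \<in> borel_measurable (G \<Otimes>\<^sub>M stream_space G)"
    proof -
      have "fst \<in> borel_measurable (G \<Otimes>\<^sub>M stream_space G)"
        using measurable_fst[of G "stream_space G"] by (simp cong: measurable_cong_sets)
      then show ?thesis by measurable
    qed
    interpret P: pair_sigma_finite G "stream_space G" ..
    have "(\<integral>\<^sup>+s. f s \<partial>push F G \<rho>) = (\<integral>\<^sup>+s. \<integral>\<^sup>+e. f (F s e) \<partial>G \<partial>\<rho>)"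
      by (intro nn_integral_push f) (simp add: \<rho>_def)
    also have "\<dots> = (\<integral>\<^sup>+\<omega>. \<integral>\<^sup>+e. f (F (B \<omega>) e) \<partial>G \<partial>stream_space G)"
      unfolding \<rho>_def by (subst nn_integral_distr) auto
    also have "\<dots> = (\<integral>\<^sup>+e. \<integral>\<^sup>+\<omega>. f (F (B \<omega>) e) \<partial>stream_space G \<partial>G)"
      using P.Fubini[OF swap] by simp
    also have "\<dots> = (\<integral>\<^sup>+e. \<integral>\<^sup>+\<omega>. f (B (e ## \<omega>)) \<partial>stream_space G \<partial>G)"
      using good by (intro nn_integral_cong nn_integral_cong_AE) (auto simp: fixpoint)
    also have "\<dots> = (\<integral>\<^sup>+\<omega>. f (B \<omega>) \<partial>stream_space G)"
      by (rule nn_integral_stream_space[symmetric]) measurable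
    also have "\<dots> = (\<integral>\<^sup>+s. f s \<partial>\<rho>)"
      unfolding \<rho>_def by (subst nn_integral_distr) auto
    finally show "(\<integral>\<^sup>+s. f s \<partial>push F G \<rho>) = (\<integral>\<^sup>+s. f s \<partial>\<rho>)" .
  qed (simp add: push_def \<rho>_def)
  ultimately show ?thesis by blast
qed

end

section \<open>The law of the chain at a fixed time\<close>

text \<open>The state at time \<open>n\<close> as a function of the initial state and of the whole stream of inputs. Together with the
independence of these two, this shows that the law at time \<open>n\<close> depends on the initial law only.\<close>

context random_map
begin

primrec forward :: "nat \<Rightarrow> 's \<Rightarrow> 'e stream \<Rightarrow> 's" where
  "forward 0 s \<omega> = s"
| "forward (Suc n) s \<omega> = forward n (F s (shd \<omega>)) (stl \<omega>)"

lemma forward_measurable [measurable (raw)]: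
  assumes "f \<in> borel_measurable M" "g \<in> M \<rightarrow>\<^sub>M stream_space G"
  shows "(\<lambda>x. forward n (f x) (g x)) \<in> borel_measurable M"
  using assms
proof (induction n arbitrary: f g)
  case (Suc n)
  note [measurable] = Suc.prems
  have "shd \<in> borel_measurable (stream_space G)"
    using measurable_shd[of G] by (simp cong: measurable_cong_sets)
  then have "(\<lambda>x. F (f x) (shd (g x))) \<in> borel_measurable M" by measurable
  then show ?case unfolding forward.simps by (rule Suc.IH) measurable
qed simp

lemma nn_integral_forward:
  assumes "\<rho> \<in> space (prob_algebra borel)" and [measurable]: "f \<in> borel_measurable borel"
  shows "(\<integral>\<^sup>+s. \<integral>\<^sup>+\<omega>. f (forward n s \<omega>) \<partial>stream_space G \<partial>\<rho>) = (\<integral>\<^sup>+s. f s \<partial>(push F G ^^ n) \<rho>)"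
  using assms(1)
proof (induction n arbitrary: \<rho>)
  case 0
  interpret S: prob_space "stream_space G" by (rule prob_space_stream_space)
  show ?case by (simp add: S.emeasure_space_1)
next
  case (Suc n)
  interpret S: prob_space "stream_space G" by (rule prob_space_stream_space)
  define g where "g s = (\<integral>\<^sup>+\<omega>. f (forward n s \<omega>) \<partial>stream_space G)" for s
  have g: "g \<in> borel_measurable borel" unfolding g_def by measurable
  have sets: "sets \<rho> = sets borel" using Suc.prems by (simp add: space_prob_algebra)
  have "(\<integral>\<^sup>+\<omega>. f (forward (Suc n) s \<omega>) \<partial>stream_space G) = (\<integral>\<^sup>+e. g (F s e) \<partial>G)" for s
    unfolding g_def by (subst nn_integral_stream_space) (auto simp del: forward.simps, simp)
  then have "(\<integral>\<^sup>+s. \<integral>\<^sup>+\<omega>. f (forward (Suc n) s \<omega>) \<partial>stream_space G \<partial>\<rho>) = (\<integral>\<^sup>+s. g s \<partial>push F G \<rho>)"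
    by (simp add: nn_integral_push[OF sets g] del: forward.simps)
  also have "\<dots> = (\<integral>\<^sup>+s. f s \<partial>(push F G ^^ n) (push F G \<rho>))"
    unfolding g_def by (intro Suc.IH push_prob Suc.prems)
  finally show ?case by (simp add: funpow_swap1)
qed

lemma distr_orbit:
  assumes M: "prob_space M"
    and [measurable]: "S 0 \<in> borel_measurable M" "\<And>n. \<xi> (Suc n) \<in> borel_measurable M"
    and orbit: "\<And>n w. w \<in> space M \<Longrightarrow> S (Suc n) w = F (S n w) (\<xi> (Suc n) w)"
    and indep: "distr M (borel \<Otimes>\<^sub>M stream_space G) (\<lambda>w. (S 0 w, to_stream (\<lambda>n. \<xi> (Suc n) w)))
        = distr M borel (S 0) \<Otimes>\<^sub>M stream_space G"
  shows "S n \<in> borel_measurable M" and "distr M borel (S n) = (push F G ^^ n) (distr M borel (S 0))"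
proof -
  interpret M: prob_space M by fact
  interpret Str: prob_space "stream_space G" by (rule prob_space_stream_space)
  let ?str = "\<lambda>w. to_stream (\<lambda>n. \<xi> (Suc n) w)"
  have [measurable]: "\<xi> (Suc n) \<in> M \<rightarrow>\<^sub>M G" for n using assms(3)[of n] by (simp cong: measurable_cong_sets)
  have str [measurable]: "?str \<in> M \<rightarrow>\<^sub>M stream_space G"
    by (rule measurable_stream_space2) (simp add: to_stream_def)
  have meas: "S n \<in> borel_measurable M" for n
  proof (induction n)
    case (Suc n)
    note [measurable] = Suc
    have "(\<lambda>w. F (S n w) (\<xi> (Suc n) w)) \<in> borel_measurable M" by measurable
    then show ?case by (simp add: orbit cong: measurable_cong)
  qed fact
  then show "S n \<in> borel_measurable M" .
  have fwd: "forward n (S k w) (sdrop k (?str w)) = S (n + k) w" if w: "w \<in> space M" for n k w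
  proof (induction n arbitrary: k)
    case (Suc n)
    have "F (S k w) (?str w !! k) = S (Suc k) w" using orbit[OF w, of k] by (simp add: to_stream_def)
    moreover have "stl (sdrop k (?str w)) = sdrop (Suc k) (?str w)" by (simp only: sdrop.simps sdrop_stl)
    ultimately show ?case using Suc[of "Suc k"]
      unfolding forward.simps sdrop_simps(1) by simp
  qed simp
  show "distr M borel (S n) = (push F G ^^ n) (distr M borel (S 0))"
  proof (rule measure_eqI_nn_integral)
    have p: "distr M borel (S 0) \<in> space (prob_algebra borel)"
      by (simp add: space_prob_algebra M.prob_space_distr)
    then show "sets (distr M borel (S n)) = sets ((push F G ^^ n) (distr M borel (S 0)))"
      by (subst sets_push_iter) auto
    fix f :: "'s \<Rightarrow> ennreal" assume "f \<in> borel_measurable ((push F G ^^ n) (distr M borel (S 0)))"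
    then have f [measurable]: "f \<in> borel_measurable borel"
      by (simp cong: measurable_cong_sets add: sets_push_iter)
    have m: "(\<lambda>p. f (forward n (fst p) (snd p))) \<in> borel_measurable (borel \<Otimes>\<^sub>M stream_space G)" by measurable
    have "(\<integral>\<^sup>+s. f s \<partial>distr M borel (S n)) = (\<integral>\<^sup>+w. f (forward n (S 0 w) (?str w)) \<partial>M)"
      using fwd[of _ n 0] meas by (subst nn_integral_distr) (auto intro!: nn_integral_cong)
    also have "\<dots> = (\<integral>\<^sup>+p. f (forward n (fst p) (snd p)) \<partial>distr M (borel \<Otimes>\<^sub>M stream_space G) (\<lambda>w. (S 0 w, ?str w)))"
      by (subst nn_integral_distr) (auto intro!: m)
    also have "\<dots> = (\<integral>\<^sup>+s. \<integral>\<^sup>+\<omega>. f (forward n s \<omega>) \<partial>stream_space G \<partial>distr M borel (S 0))"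
      unfolding indep by (subst Str.nn_integral_fst[symmetric]) auto
    also have "\<dots> = (\<integral>\<^sup>+s. f s \<partial>(push F G ^^ n) (distr M borel (S 0)))"
      by (rule nn_integral_forward[OF p f])
    finally show "(\<integral>\<^sup>+s. f s \<partial>distr M borel (S n)) = (\<integral>\<^sup>+s. f s \<partial>(push F G ^^ n) (distr M borel (S 0)))" .
  qed
qed

end

section \<open>Gaussian inputs\<close>

text \<open>Lebesgue measure factorises over \<open>Basis\<close>, the Gaussian density over the index type; the choice operator inverts
the bijection \<open>i \<mapsto> axis i 1\<close>.\<close>

lemma prod_coordinates_eq:
  fixes x :: "real^'d::finite" and f :: "'d::finite \<Rightarrow> real \<Rightarrow> 'a::comm_monoid_mult"
  shows "(\<Prod>b\<in>Basis. f (SOME i. b = axis i 1) (x \<bullet> b)) = (\<Prod>i\<in>UNIV. f i (x $ i))"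
proof -
  have B: "Basis = range (\<lambda>i. axis i (1::real) :: real^'d)" by (auto simp: Basis_vec_def)
  have inj: "inj (\<lambda>i. axis i (1::real) :: real^'d)" by (auto simp: inj_on_def axis_eq_axis)
  have "(SOME j. axis i (1::real) = (axis j 1 :: real^'d)) = i" for i
    by (rule some_equality) (auto simp: axis_eq_axis)
  then show ?thesis unfolding B prod.reindex[OF inj] by (simp add: inner_axis)
qed

lemma nn_integral_prod_coordinates:
  fixes f :: "'d::finite \<Rightarrow> real \<Rightarrow> ennreal"
  assumes [measurable]: "\<And>i. f i \<in> borel_measurable borel"
  shows "(\<integral>\<^sup>+(x :: real^'d). (\<Prod>i\<in>UNIV. f i (x $ i)) \<partial>lborel) = (\<Prod>i\<in>UNIV. \<integral>\<^sup>+t. f i t \<partial>lborel)"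
proof -
  have "(\<integral>\<^sup>+(x :: real^'d). (\<Prod>i\<in>UNIV. f i (x $ i)) \<partial>lborel)
      = (\<Prod>b\<in>(Basis :: (real^'d) set). \<integral>\<^sup>+t. f (SOME i. b = axis i 1) t \<partial>lborel)"
    unfolding prod_coordinates_eq[symmetric] by (rule nn_integral_lborel_prod) auto
  also have "\<dots> = (\<Prod>i\<in>UNIV. \<integral>\<^sup>+t. f i t \<partial>lborel)"
    using prod_coordinates_eq[of "\<lambda>i _. \<integral>\<^sup>+t. f i t \<partial>lborel" "0 :: real^'d"] by simp
  finally show ?thesis .
qed

lemma nn_integral_std_normal_density: "(\<integral>\<^sup>+t. ennreal (std_normal_density t) \<partial>lborel) = 1"
  using prob_space.emeasure_space_1[OF prob_space_normal_density[of 1 0]]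
  by (simp add: emeasure_density)

lemma sets_std_gaussian [measurable_cong, simp]: "sets std_gaussian = sets borel"
  by (simp add: std_gaussian_def)

lemma space_std_gaussian [simp]: "space std_gaussian = UNIV"
  by (simp add: std_gaussian_def)

lemma prob_space_std_gaussian: "prob_space (std_gaussian :: (real^'d) measure)"
proof
  have "emeasure (std_gaussian :: (real^'d) measure) (space std_gaussian)
      = (\<integral>\<^sup>+x. (\<Prod>i\<in>UNIV. ennreal (std_normal_density (x $ i))) \<partial>(lborel :: (real^'d) measure))"
    by (simp add: std_gaussian_def emeasure_density prod_ennreal)
  also have "\<dots> = 1"
    by (subst nn_integral_prod_coordinates) (simp_all add: nn_integral_std_normal_density)
  finally show "emeasure (std_gaussian :: (real^'d) measure) (space std_gaussian) = 1" .
qed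

lemma std_gaussian_second_moment:
  "(\<integral>\<^sup>+(x :: real^'d). ennreal ((norm x)\<^sup>2) \<partial>std_gaussian) < \<top>"
proof -
  let ?\<phi> = std_normal_density
  have sm: "(\<integral>\<^sup>+t. ennreal (t\<^sup>2 * ?\<phi> t) \<partial>lborel) < \<top>"
    using integrable_std_normal_moment[of 2]
    by (subst nn_integral_eq_integral) (auto simp: mult.commute)
  have coord: "(\<integral>\<^sup>+(x :: real^'d). ennreal ((x $ j)\<^sup>2) * (\<Prod>i\<in>UNIV. ennreal (?\<phi> (x $ i))) \<partial>lborel) < \<top>" for j
  proof -
    \<comment> \<open>The second moment of one coordinate is again an integral over a product of functions of the single
      coordinates.\<close>
    define f where "f i t = (if i = j then ennreal (t\<^sup>2) else 1) * ennreal (?\<phi> t)" for i :: 'd and t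
    have "(\<integral>\<^sup>+(x :: real^'d). ennreal ((x $ j)\<^sup>2) * (\<Prod>i\<in>UNIV. ennreal (?\<phi> (x $ i))) \<partial>lborel)
        = (\<integral>\<^sup>+(x :: real^'d). (\<Prod>i\<in>UNIV. f i (x $ i)) \<partial>lborel)"
      by (intro nn_integral_cong) (simp add: f_def prod.distrib prod.delta)
    also have "\<dots> = (\<Prod>i\<in>UNIV. \<integral>\<^sup>+t. f i t \<partial>lborel)"
      by (rule nn_integral_prod_coordinates) (simp add: f_def)
    also have "\<dots> < \<top>"
    proof -
      have "(\<integral>\<^sup>+t. f i t \<partial>lborel) < \<top>" for i
        using sm by (cases "i = j") (auto simp: f_def ennreal_mult'' nn_integral_std_normal_density)
      then show ?thesis by (induction rule: infinite_finite_induct) (auto simp: ennreal_mult_less_top)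
    qed
    finally show ?thesis .
  qed
  have sq: "ennreal ((norm x)\<^sup>2) = (\<Sum>j\<in>UNIV. ennreal ((x $ j)\<^sup>2))" for x :: "real^'d"
    by (simp add: norm_vec_def L2_set_def sum_nonneg sum_ennreal)
  have "(\<integral>\<^sup>+(x :: real^'d). ennreal ((norm x)\<^sup>2) \<partial>std_gaussian)
      = (\<integral>\<^sup>+(x :: real^'d). (\<Prod>i\<in>UNIV. ennreal (?\<phi> (x $ i))) * ennreal ((norm x)\<^sup>2) \<partial>lborel)"
    unfolding std_gaussian_def by (subst nn_integral_density) (auto simp: prod_ennreal)
  also have "\<dots> = (\<integral>\<^sup>+(x :: real^'d). (\<Sum>j\<in>UNIV. ennreal ((x $ j)\<^sup>2) * (\<Prod>i\<in>UNIV. ennreal (?\<phi> (x $ i)))) \<partial>lborel)"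
    by (intro nn_integral_cong) (simp only: sq mult.commute[of "prod _ _"] sum_distrib_right)
  also have "\<dots> = (\<Sum>j\<in>UNIV. \<integral>\<^sup>+(x :: real^'d). ennreal ((x $ j)\<^sup>2) * (\<Prod>i\<in>UNIV. ennreal (?\<phi> (x $ i))) \<partial>lborel)"
    by (rule nn_integral_sum) measurable
  also have "\<dots> < \<top>" using coord by simp
  finally show ?thesis .
qed

text \<open>The inputs have indices \<open>1, 2, \<dots>\<close>; shifting them to a stream preserves the product law by reindexing.
Independence passes from \<open>Z\<close> and the restricted family to the images \<open>h (Z w)\<close> and the stream, because an
event about the images is an event about the originals.\<close>

lemma gaussian_inputs_independent:
  fixes \<xi> :: "nat \<Rightarrow> 'w \<Rightarrow> real^'d" and Z :: "'w \<Rightarrow> 'z::topological_space" and h :: "'z \<Rightarrow> 's::topological_space"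
  assumes "prob_space M" and inputs: "gaussian_inputs M \<xi> Z"
    and Z: "Z \<in> borel_measurable M" and h: "h \<in> borel_measurable borel"
  shows "\<xi> (Suc n) \<in> borel_measurable M"
    and "distr M (borel \<Otimes>\<^sub>M stream_space std_gaussian) (\<lambda>w. (h (Z w), to_stream (\<lambda>n. \<xi> (Suc n) w)))
      = distr M borel (\<lambda>w. h (Z w)) \<Otimes>\<^sub>M stream_space std_gaussian"
proof -
  interpret prob_space M by fact
  interpret G: prob_space "std_gaussian :: (real^'d) measure" by (rule prob_space_std_gaussian)
  interpret SG: prob_space "stream_space std_gaussian :: (real^'d) stream measure" by (rule G.prob_space_stream_space)
  have iv: "indep_vars (\<lambda>_. borel) \<xi> {1..}" and law: "\<And>n. n \<ge> 1 \<Longrightarrow> distr M borel (\<xi> n) = std_gaussian"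
    and ind: "indep_set (sets (vimage_algebra (space M) Z borel))
       (sets (vimage_algebra (space M) (\<lambda>w. \<lambda>n\<in>{1..}. \<xi> n w) (Pi\<^sub>M {1..} (\<lambda>_. borel))))"
    using inputs by (auto simp: gaussian_inputs_def)
  have \<xi>: "\<xi> n \<in> borel_measurable M" if "n \<in> {1..}" for n
    using iv that by (auto simp: indep_vars_def)
  then show \<xi>': "\<xi> (Suc n) \<in> borel_measurable M" for n by simp
  let ?P = "Pi\<^sub>M {1..} (\<lambda>_. borel) :: (nat \<Rightarrow> real^'d) measure" and ?R = "\<lambda>w. \<lambda>n\<in>{1..}. \<xi> n w"
  let ?S = "stream_space std_gaussian :: (real^'d) stream measure"
  let ?str = "\<lambda>w. to_stream (\<lambda>n. \<xi> (Suc n) w)"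
  define T where "T \<omega> = to_stream (\<lambda>n. \<omega> (Suc n))" for \<omega> :: "nat \<Rightarrow> real^'d"
  have T: "T \<in> ?P \<rightarrow>\<^sub>M ?S"
  proof (rule measurable_stream_space2)
    fix n
    have "(\<lambda>\<omega>. \<omega> (Suc n)) \<in> ?P \<rightarrow>\<^sub>M borel" by (rule measurable_component_singleton) simp
    then show "(\<lambda>\<omega>. T \<omega> !! n) \<in> ?P \<rightarrow>\<^sub>M std_gaussian"
      by (simp add: T_def to_stream_def cong: measurable_cong_sets)
  qed
  have R: "?R \<in> M \<rightarrow>\<^sub>M ?P" by (rule measurable_restrict) (rule \<xi>)
  have str: "?str = T \<circ> ?R" by (auto simp: T_def fun_eq_iff)
  have str_meas [measurable]: "?str \<in> M \<rightarrow>\<^sub>M ?S" unfolding str by (rule measurable_comp[OF R T])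
  have law_str: "distr M ?S ?str = ?S"
  proof -
    have "distr M ?P ?R = (\<Pi>\<^sub>M i\<in>{1..}. distr M borel (\<xi> i))"
      using indep_vars_iff_distr_eq_PiM'[where I = "{1..}" and M' = "\<lambda>_. borel" and X = \<xi>, THEN iffD1] iv \<xi> by auto
    also have "\<dots> = (\<Pi>\<^sub>M i\<in>{1..}. std_gaussian)" by (intro PiM_cong law) auto
    finally have 1: "distr M ?P ?R = (\<Pi>\<^sub>M i\<in>{1::nat..}. (std_gaussian :: (real^'d) measure))" .
    have 2: "distr (\<Pi>\<^sub>M i\<in>{1::nat..}. (std_gaussian :: (real^'d) measure)) (\<Pi>\<^sub>M i\<in>UNIV. std_gaussian) (\<lambda>\<omega>. \<lambda>n\<in>UNIV. \<omega> (Suc n))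
        = (\<Pi>\<^sub>M i\<in>(UNIV :: nat set). (std_gaussian :: (real^'d) measure))"
      by (rule distr_PiM_reindex) (auto simp: prob_space_std_gaussian)
    have 3: "(\<lambda>\<omega> n. \<omega> (Suc n)) \<in> (\<Pi>\<^sub>M i\<in>{1::nat..}. (std_gaussian :: (real^'d) measure)) \<rightarrow>\<^sub>M (\<Pi>\<^sub>M i\<in>(UNIV :: nat set). (std_gaussian :: (real^'d) measure))"
      by (rule measurable_PiM_single') (auto intro!: measurable_component_singleton)
    have "distr M ?S ?str = distr (distr M ?P ?R) ?S T" unfolding str by (rule distr_distr[OF T R, symmetric])
    also have "\<dots> = distr (distr (\<Pi>\<^sub>M i\<in>{1::nat..}. std_gaussian) (\<Pi>\<^sub>M i\<in>UNIV. std_gaussian) (\<lambda>\<omega> n. \<omega> (Suc n))) ?S to_stream"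
      unfolding 1 by (subst distr_distr[OF measurable_to_stream 3]) (simp add: T_def[abs_def] comp_def)
    also have "\<dots> = ?S" using 2 by (simp add: restrict_def stream_space_eq_distr[symmetric])
    finally show ?thesis .
  qed
  have hZ [measurable]: "(\<lambda>w. h (Z w)) \<in> borel_measurable M" using Z h by measurable
  show "distr M (borel \<Otimes>\<^sub>M ?S) (\<lambda>w. (h (Z w), ?str w)) = distr M borel (\<lambda>w. h (Z w)) \<Otimes>\<^sub>M ?S"
  proof (rule pair_measure_eqI[symmetric])
    show "sigma_finite_measure (distr M borel (\<lambda>w. h (Z w)))"
      by (intro prob_space_imp_sigma_finite prob_space_distr hZ)
    show "sigma_finite_measure ?S" by (rule SG.sigma_finite_measure_axioms)
    show "sets (distr M borel (\<lambda>w. h (Z w)) \<Otimes>\<^sub>M ?S) = sets (distr M (borel \<Otimes>\<^sub>M ?S) (\<lambda>w. (h (Z w), ?str w)))"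
      by (simp cong: sets_pair_measure_cong)
    fix A B assume "A \<in> sets (distr M borel (\<lambda>w. h (Z w)))" and B: "B \<in> sets ?S"
    then have A: "A \<in> sets borel" by simp
    have a: "(\<lambda>w. h (Z w)) -` A \<inter> space M \<in> sets (vimage_algebra (space M) Z borel)"
      using in_vimage_algebra[OF measurable_sets[OF h A], of Z "space M"] by (simp add: vimage_def)
    have b: "?str -` B \<inter> space M \<in> sets (vimage_algebra (space M) ?R ?P)"
    proof -
      have "?str -` B \<inter> space M = ?R -` (T -` B \<inter> space ?P) \<inter> space M"
        using measurable_space[OF R] by (auto simp: str)
      then show ?thesis using in_vimage_algebra[OF measurable_sets[OF T B], of ?R "space M"] by simp
    qed
    have "emeasure (distr M borel (\<lambda>w. h (Z w))) A * emeasure ?S B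
        = emeasure (distr M borel (\<lambda>w. h (Z w))) A * emeasure (distr M ?S ?str) B"
      by (simp add: law_str)
    also have "\<dots> = ennreal (prob ((\<lambda>w. h (Z w)) -` A \<inter> space M) * prob (?str -` B \<inter> space M))"
      using A B by (simp add: emeasure_distr emeasure_eq_measure ennreal_mult)
    also have "\<dots> = emeasure M (((\<lambda>w. h (Z w)) -` A \<inter> space M) \<inter> (?str -` B \<inter> space M))"
      unfolding indep_setD[OF ind a b, symmetric] emeasure_eq_measure ..
    also have "\<dots> = emeasure (distr M (borel \<Otimes>\<^sub>M ?S) (\<lambda>w. (h (Z w), ?str w))) (A \<times> B)"
      using A B by (subst emeasure_distr) (auto intro!: arg_cong[where f = "emeasure M"])
    finally show "emeasure (distr M borel (\<lambda>w. h (Z w))) A * emeasure ?S B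
        = emeasure (distr M (borel \<Otimes>\<^sub>M ?S) (\<lambda>w. (h (Z w), ?str w))) (A \<times> B)" .
  qed
qed

section \<open>Transport costs\<close>

lemma esqrt_mono: "s \<le> t \<Longrightarrow> esqrt s \<le> esqrt t"
  by (auto simp: esqrt_def top_unique intro!: ennreal_leI enn2real_mono simp: less_top)

lemma esqrt_cmult:
  assumes "0 \<le> k" shows "esqrt (ennreal k * t) = ennreal (sqrt k) * esqrt t"
proof (cases t)
  case (real x)
  with assms show ?thesis
    by (simp add: esqrt_def ennreal_mult[symmetric] real_sqrt_mult)
next
  case top
  with assms show ?thesis by (cases "k = 0") (simp_all add: esqrt_def ennreal_mult_top)
qed

text \<open>The factor is positive and finite, so it can be divided out of the hypothesis even at the value \<open>\<infinity>\<close>.\<close>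

lemma le_cmult_INF:
  fixes L :: ennreal
  assumes k: "0 < k" and le: "\<And>x. x \<in> A \<Longrightarrow> L \<le> ennreal k * g x"
  shows "L \<le> ennreal k * (INF x\<in>A. g x)"
proof -
  have one: "ennreal k * ennreal (1 / k) = 1" using k by (simp add: ennreal_mult[symmetric])
  have "ennreal (1 / k) * L \<le> (INF x\<in>A. g x)"
  proof (rule INF_greatest)
    fix x assume "x \<in> A"
    then have "ennreal (1 / k) * L \<le> ennreal (1 / k) * (ennreal k * g x)" by (intro mult_left_mono le) auto
    also have "\<dots> = g x" using one by (simp add: mult.assoc[symmetric] mult.commute[of "ennreal (1 / k)"])
    finally show "ennreal (1 / k) * L \<le> g x" .
  qed
  then have "ennreal k * (ennreal (1 / k) * L) \<le> ennreal k * (INF x\<in>A. g x)" by (intro mult_left_mono) auto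
  then show ?thesis using one by (simp add: mult.assoc[symmetric])
qed

lemma transport_eq:
  "transport a b \<pi> \<pi>' = (INF \<gamma>\<in>couplings \<pi> \<pi>'. esqrt (\<integral>\<^sup>+ (p, p').
     ennreal (a * (norm (fst p - fst p'))\<^sup>2 + b * (norm (snd p - snd p'))\<^sup>2) \<partial>\<gamma>))"
  by (simp add: transport_def case_prod_unfold)

lemma borel_fst [measurable]: "fst \<in> borel_measurable (borel :: ('a::second_countable_topology \<times> 'b::second_countable_topology) measure)"
  unfolding borel_prod[symmetric] by measurable

lemma borel_snd [measurable]: "snd \<in> borel_measurable (borel :: ('a::second_countable_topology \<times> 'b::second_countable_topology) measure)"
  unfolding borel_prod[symmetric] by measurable

lemma couplings_distr:
  fixes h :: "'a::second_countable_topology \<Rightarrow> 'b::second_countable_topology"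
  assumes \<gamma>: "\<gamma> \<in> couplings \<mu> \<nu>" and h [measurable]: "h \<in> borel_measurable borel"
  shows "distr \<gamma> borel (\<lambda>(x, x'). (h x, h x')) \<in> couplings (distr \<mu> borel h) (distr \<nu> borel h)"
proof -
  have p: "sets \<gamma> = sets borel" "prob_space \<gamma>" "distr \<gamma> borel fst = \<mu>" "distr \<gamma> borel snd = \<nu>"
    using \<gamma> by (auto simp: couplings_def space_prob_algebra)
  note [measurable_cong] = p(1)
  interpret prob_space \<gamma> by (rule p)
  have [measurable]: "fst \<in> borel_measurable \<gamma>" "snd \<in> borel_measurable \<gamma>"
    using p(1) by (auto cong: measurable_cong_sets)
  have m [measurable]: "(\<lambda>(x, x'). (h x, h x')) \<in> borel_measurable \<gamma>"
    unfolding case_prod_beta borel_prod[symmetric] by measurable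
  show ?thesis
    unfolding couplings_def p(3,4)[symmetric]
    by (auto simp: space_prob_algebra prob_space_distr distr_distr comp_def case_prod_beta)
qed

text \<open>The infimum is tested with the image under \<open>h\<close> of the coupling that synchronous steps produce from \<open>\<Gamma>\<close>. The
observable \<open>h\<close> is there because the theorem measures distances between parts of the state only.\<close>

lemma (in contractive_random_map) transport_cost_le:
  fixes h :: "'s \<Rightarrow> 't::second_countable_topology"
  assumes \<Gamma>: "\<Gamma> \<in> couplings \<rho> \<rho>'" and h: "h \<in> borel_measurable borel"
    and cost: "(\<lambda>(x, x'). ennreal (cost x x')) \<in> borel_measurable borel"
    and k: "0 \<le> k" "\<And>s s'. cost (h s) (h s') \<le> k * V (s - s')"
  shows "(INF \<gamma>\<in>couplings (distr ((push F G ^^ n) \<rho>) borel h) (distr ((push F G ^^ n) \<rho>') borel h).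
      esqrt (\<integral>\<^sup>+(x, x'). ennreal (cost x x') \<partial>\<gamma>))
    \<le> ennreal (sqrt (k * \<theta> ^ n)) * esqrt (\<integral>\<^sup>+(s, s'). ennreal (V (s - s')) \<partial>\<Gamma>)"
proof -
  let ?\<Gamma> = "(push (synchronous F) G ^^ n) \<Gamma>"
  have \<Gamma>': "\<Gamma> \<in> space (prob_algebra borel)" using \<Gamma> by (simp add: couplings_def)
  have c: "?\<Gamma> \<in> couplings ((push F G ^^ n) \<rho>) ((push F G ^^ n) \<rho>')" by (rule synchronous_coupling[OF \<Gamma>])
  then have sets: "sets ?\<Gamma> = sets borel" by (simp add: couplings_def space_prob_algebra)
  let ?h = "\<lambda>(x, x'). (h x, h x')"
  note [measurable] = h
  have m: "?h \<in> borel_measurable ?\<Gamma>"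
  proof -
    have "?h \<in> borel_measurable borel" unfolding case_prod_beta borel_prod[symmetric] by measurable
    then show ?thesis using sets by (simp cong: measurable_cong_sets)
  qed
  have V: "(\<lambda>(s, s'). ennreal (V (s - s'))) \<in> borel_measurable ?\<Gamma>"
  proof -
    have "(\<lambda>(s, s'). ennreal (V (s - s'))) \<in> borel_measurable borel"
      unfolding case_prod_beta borel_prod[symmetric] by measurable
    then show ?thesis using sets by (simp cong: measurable_cong_sets)
  qed
  have "(\<integral>\<^sup>+(x, x'). ennreal (cost x x') \<partial>distr ?\<Gamma> borel ?h) = (\<integral>\<^sup>+(s, s'). ennreal (cost (h s) (h s')) \<partial>?\<Gamma>)"
    by (subst nn_integral_distr[OF m]) (use cost in \<open>auto simp: case_prod_unfold\<close>)
  also have "\<dots> \<le> (\<integral>\<^sup>+p. ennreal k * (case p of (s, s') \<Rightarrow> ennreal (V (s - s'))) \<partial>?\<Gamma>)"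
    using k by (intro nn_integral_mono) (auto simp: ennreal_mult'[symmetric] intro!: ennreal_leI)
  also have "\<dots> = ennreal k * (\<integral>\<^sup>+(s, s'). ennreal (V (s - s')) \<partial>?\<Gamma>)" by (rule nn_integral_cmult[OF V])
  also have "\<dots> \<le> ennreal k * (ennreal (\<theta> ^ n) * (\<integral>\<^sup>+(s, s'). ennreal (V (s - s')) \<partial>\<Gamma>))"
    by (intro mult_left_mono synchronous_contraction[OF \<Gamma>']) auto
  also have "\<dots> = ennreal (k * \<theta> ^ n) * (\<integral>\<^sup>+(s, s'). ennreal (V (s - s')) \<partial>\<Gamma>)"
    using k \<theta>_nonneg by (simp add: ennreal_mult mult.assoc)
  finally have "esqrt (\<integral>\<^sup>+(x, x'). ennreal (cost x x') \<partial>distr ?\<Gamma> borel ?h)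
      \<le> ennreal (sqrt (k * \<theta> ^ n)) * esqrt (\<integral>\<^sup>+(s, s'). ennreal (V (s - s')) \<partial>\<Gamma>)"
    using k \<theta>_nonneg by (simp add: esqrt_cmult[symmetric] esqrt_mono)
  then show ?thesis by (rule INF_lower2[OF couplings_distr[OF c h]])
qed

lemma P2_distr:
  fixes h :: "'a::{real_normed_vector, second_countable_topology} \<Rightarrow> 'b::{real_normed_vector, second_countable_topology}"
  assumes \<mu>: "\<mu> \<in> P2" and h: "h \<in> borel_measurable borel" and k: "0 \<le> k" "\<And>x. (norm (h x))\<^sup>2 \<le> k * (norm x)\<^sup>2"
  shows "distr \<mu> borel h \<in> P2"
proof -
  have p: "sets \<mu> = sets borel" "prob_space \<mu>" and fin: "(\<integral>\<^sup>+x. ennreal ((norm x)\<^sup>2) \<partial>\<mu>) < \<top>"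
    using \<mu> by (auto simp: P2_def space_prob_algebra)
  have m: "h \<in> borel_measurable \<mu>" using h p by (simp cong: measurable_cong_sets)
  have n: "(\<lambda>x. ennreal ((norm x)\<^sup>2)) \<in> borel_measurable \<mu>" using p by (simp cong: measurable_cong_sets)
  have "(\<integral>\<^sup>+x. ennreal ((norm x)\<^sup>2) \<partial>distr \<mu> borel h) = (\<integral>\<^sup>+x. ennreal ((norm (h x))\<^sup>2) \<partial>\<mu>)"
    by (rule nn_integral_distr[OF m]) measurable
  also have "\<dots> \<le> (\<integral>\<^sup>+x. ennreal k * ennreal ((norm x)\<^sup>2) \<partial>\<mu>)"
    using k by (intro nn_integral_mono) (auto simp: ennreal_mult'[symmetric] intro!: ennreal_leI)
  also have "\<dots> = ennreal k * (\<integral>\<^sup>+x. ennreal ((norm x)\<^sup>2) \<partial>\<mu>)" by (rule nn_integral_cmult[OF n])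
  also have "\<dots> < \<top>" using fin by (simp add: ennreal_mult_less_top)
  finally show ?thesis using p m by (simp add: P2_def space_prob_algebra prob_space.prob_space_distr)
qed

lemma pair_measure_coupling:
  fixes \<mu> :: "'a::second_countable_topology measure" and \<nu> :: "'b::second_countable_topology measure"
  assumes "\<mu> \<in> space (prob_algebra borel)" "\<nu> \<in> space (prob_algebra borel)"
  shows "\<mu> \<Otimes>\<^sub>M \<nu> \<in> couplings \<mu> \<nu>"
proof -
  have p: "sets \<mu> = sets borel" "prob_space \<mu>" "sets \<nu> = sets borel" "prob_space \<nu>"
    using assms by (auto simp: space_prob_algebra)
  interpret A: prob_space \<mu> by fact
  interpret B: prob_space \<nu> by fact
  interpret P: pair_prob_space \<mu> \<nu> ..
  have s: "sets (\<mu> \<Otimes>\<^sub>M \<nu>) = sets borel"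
    using p(1,3) by (simp add: borel_prod[symmetric] cong: sets_pair_measure_cong)
  have "distr (\<mu> \<Otimes>\<^sub>M \<nu>) borel fst = distr (\<mu> \<Otimes>\<^sub>M \<nu>) \<mu> fst" using p by (intro distr_cong) auto
  also have "\<dots> = \<mu>" by (rule B.distr_pair_fst)
  finally have f: "distr (\<mu> \<Otimes>\<^sub>M \<nu>) borel fst = \<mu>" .
  have "distr (\<mu> \<Otimes>\<^sub>M \<nu>) borel snd = \<nu>"
  proof (rule measure_eqI)
    fix A assume "A \<in> sets (distr (\<mu> \<Otimes>\<^sub>M \<nu>) borel snd)"
    then have A: "A \<in> sets \<nu>" using p by simp
    have "snd \<in> \<mu> \<Otimes>\<^sub>M \<nu> \<rightarrow>\<^sub>M borel" using p(3) measurable_snd[of \<mu> \<nu>] by (simp cong: measurable_cong_sets)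
    then have "emeasure (distr (\<mu> \<Otimes>\<^sub>M \<nu>) borel snd) A = emeasure (\<mu> \<Otimes>\<^sub>M \<nu>) (space \<mu> \<times> A)"
      using A p by (subst emeasure_distr)
        (auto simp: space_pair_measure intro!: arg_cong[where f = "emeasure _"] dest: sets.sets_into_space)
    also have "\<dots> = emeasure \<nu> A" using A by (simp add: B.emeasure_pair_measure_Times A.emeasure_space_1)
    finally show "emeasure (distr (\<mu> \<Otimes>\<^sub>M \<nu>) borel snd) A = emeasure \<nu> A" .
  qed (simp add: p)
  then show ?thesis using f s P.prob_space_axioms by (simp add: couplings_def space_prob_algebra)
qed

lemma P2_pair_sq_dist_finite:
  fixes \<mu> \<nu> :: "'a::{real_normed_vector, second_countable_topology} measure"
  assumes "\<mu> \<in> P2" "\<nu> \<in> P2"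
  shows "(\<integral>\<^sup>+(s, s'). ennreal ((norm (s - s'))\<^sup>2) \<partial>(\<mu> \<Otimes>\<^sub>M \<nu>)) < \<top>"
proof -
  have p: "sets \<mu> = sets borel" "prob_space \<mu>" "sets \<nu> = sets borel" "prob_space \<nu>"
    and fin: "(\<integral>\<^sup>+x. ennreal ((norm x)\<^sup>2) \<partial>\<mu>) < \<top>" "(\<integral>\<^sup>+x. ennreal ((norm x)\<^sup>2) \<partial>\<nu>) < \<top>"
    using assms by (auto simp: P2_def space_prob_algebra)
  note [measurable_cong] = p(1,3)
  interpret A: prob_space \<mu> by fact
  interpret B: prob_space \<nu> by fact
  have le: "(norm (s - s'))\<^sup>2 \<le> 2 * (norm s)\<^sup>2 + 2 * (norm s')\<^sup>2" for s s' :: 'a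
  proof -
    have "(norm (s - s'))\<^sup>2 \<le> (norm s + norm s')\<^sup>2" by (intro power_mono norm_triangle_ineq4) auto
    also have "\<dots> \<le> 2 * (norm s)\<^sup>2 + 2 * (norm s')\<^sup>2"
      using zero_le_power2[of "norm s - norm s'"] by (simp add: power2_eq_square algebra_simps)
    finally show ?thesis .
  qed
  have [measurable]: "fst \<in> borel_measurable (\<mu> \<Otimes>\<^sub>M \<nu>)" "snd \<in> borel_measurable (\<mu> \<Otimes>\<^sub>M \<nu>)"
    using measurable_fst[of \<mu> \<nu>] measurable_snd[of \<mu> \<nu>] p by (simp_all cong: measurable_cong_sets)
  have "(\<integral>\<^sup>+(s, s'). ennreal ((norm (s - s'))\<^sup>2) \<partial>(\<mu> \<Otimes>\<^sub>M \<nu>))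
      \<le> (\<integral>\<^sup>+q. 2 * ennreal ((norm (fst q))\<^sup>2) + 2 * ennreal ((norm (snd q))\<^sup>2) \<partial>(\<mu> \<Otimes>\<^sub>M \<nu>))"
  proof (rule nn_integral_mono)
    fix q :: "'a \<times> 'a"
    have "ennreal ((norm (fst q - snd q))\<^sup>2) \<le> ennreal (2 * (norm (fst q))\<^sup>2 + 2 * (norm (snd q))\<^sup>2)"
      by (rule ennreal_leI[OF le])
    then show "(case q of (s, s') \<Rightarrow> ennreal ((norm (s - s'))\<^sup>2))
        \<le> 2 * ennreal ((norm (fst q))\<^sup>2) + 2 * ennreal ((norm (snd q))\<^sup>2)"
      by (simp add: case_prod_beta ennreal_mult)
  qed
  also have "\<dots> = 2 * (\<integral>\<^sup>+q. ennreal ((norm (fst q))\<^sup>2) \<partial>(\<mu> \<Otimes>\<^sub>M \<nu>)) + 2 * (\<integral>\<^sup>+q. ennreal ((norm (snd q))\<^sup>2) \<partial>(\<mu> \<Otimes>\<^sub>M \<nu>))"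
    by (subst nn_integral_add) (auto simp: nn_integral_cmult)
  also have "(\<integral>\<^sup>+q. ennreal ((norm (fst q))\<^sup>2) \<partial>(\<mu> \<Otimes>\<^sub>M \<nu>)) = (\<integral>\<^sup>+x. ennreal ((norm x)\<^sup>2) \<partial>\<mu>)"
    by (subst B.nn_integral_fst[symmetric]) (auto simp: B.emeasure_space_1)
  also have "(\<integral>\<^sup>+q. ennreal ((norm (snd q))\<^sup>2) \<partial>(\<mu> \<Otimes>\<^sub>M \<nu>)) = (\<integral>\<^sup>+x. ennreal ((norm x)\<^sup>2) \<partial>\<nu>)"
    by (subst B.nn_integral_fst[symmetric]) (auto simp: A.emeasure_space_1)
  finally show ?thesis using fin by (auto simp: ennreal_mult_less_top elim!: le_less_trans)
qed

section \<open>The primal-dual Langevin chain\<close>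

text \<open>Cauchy-Schwarz turns the hypothesis into \<open>|P z - P z'| \<le> |z - z'|\<close>.\<close>

lemma continuous_if_firmly_nonexpansive:
  fixes P :: "'a::real_inner \<Rightarrow> 'a"
  assumes "\<And>z z'. 0 \<le> ((z - z') - (P z - P z')) \<bullet> (P z - P z')"
  shows "continuous_on UNIV P"
proof -
  have "dist (P z) (P z') \<le> 1 * dist z z'" for z z'
  proof (cases "P z = P z'")
    case False
    have "(norm (P z - P z'))\<^sup>2 \<le> (z - z') \<bullet> (P z - P z')"
      using assms[of z z'] by (simp add: inner_diff_left power2_norm_eq_inner)
    also have "\<dots> \<le> norm (z - z') * norm (P z - P z')" by (rule norm_cauchy_schwarz)
    finally show ?thesis using False by (simp add: power2_eq_square dist_norm)
  qed simp
  then have "1-lipschitz_on UNIV P" by (intro lipschitz_onI) auto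
  then show ?thesis by (rule lipschitz_on_continuous_on)
qed

lemma continuous_linear: "linear h \<Longrightarrow> continuous_on A h" for h :: "'x::euclidean_space \<Rightarrow> 'y::euclidean_space"
  by (simp add: linear_continuous_on linear_conv_bounded_linear)

text \<open>The parameter bounds appear in multiplied-out form. Properness of \<open>f\<close> and \<open>g\<close> is what positivity of
the integral of \<open>exp(-f(Kx) - g(x))\<close> provides.\<close>

locale primal_dual =
  fixes K :: "real^'d \<Rightarrow> real^'m" and f :: "real^'m \<Rightarrow> ereal" and g :: "real^'d \<Rightarrow> ereal"
    and \<omega>\<^sub>g \<omega>\<^sub>f \<tau> \<sigma> \<theta> :: real
  assumes K: "linear K"
    and f: "\<And>y. f y \<noteq> -\<infinity>" "econvex f" "lsc f" "\<exists>y. f y \<noteq> \<infinity>"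
    and g: "\<And>x. g x \<noteq> -\<infinity>" "lsc g" "\<exists>x. g x \<noteq> \<infinity>"
    and \<omega>\<^sub>g: "0 < \<omega>\<^sub>g" "strongly_econvex \<omega>\<^sub>g g"
    and \<omega>\<^sub>f: "0 < \<omega>\<^sub>f" "strongly_econvex \<omega>\<^sub>f (conjugate f)"
    and steps: "0 < \<tau>" "0 < \<sigma>"
    and \<theta>_ge: "1 \<le> \<theta> * (1 + 2 * \<omega>\<^sub>g * \<tau>)" "1 \<le> \<theta> * (1 + 2 * \<omega>\<^sub>f * \<sigma>)" and \<theta>_less: "\<theta> < 1"
    and coupling_const: "\<theta> * \<sigma> * \<tau> * (onorm K)\<^sup>2 \<le> 1"
begin

text \<open>The weight of the dual part of the cost is \<open>1/\<lambda>'\<close> with \<open>\<lambda>' = a \<sigma> / (b \<tau>)\<close>.\<close>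

abbreviation "a \<equiv> 1 + 2 * \<omega>\<^sub>g * \<tau>"
abbreviation "b \<equiv> 1 + 2 * \<omega>\<^sub>f * \<sigma>"
abbreviation "q \<equiv> \<theta> * \<sigma> * \<tau> * (onorm K)\<^sup>2"
abbreviation "step \<equiv> pd_step K f g \<tau> \<sigma> \<theta>"
abbreviation "V \<equiv> pd_lyapunov K a b \<tau> \<sigma> \<theta>"
abbreviation "weight \<equiv> b * \<tau> / (a * \<sigma>)"

lemma ab: "1 < a" "1 < b"
  using \<omega>\<^sub>g \<omega>\<^sub>f steps by auto

lemma \<theta>_pos: "0 < \<theta>"
proof -
  have "0 < \<theta> * a" using \<theta>_ge by simp
  then show ?thesis using ab by (simp add: zero_less_mult_iff)
qed

lemma prox_dual:
  "\<sigma> * \<omega>\<^sub>f * (norm (prox \<sigma> (conjugate f) z - prox \<sigma> (conjugate f) z'))\<^sup>2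
    \<le> ((z - z') - (prox \<sigma> (conjugate f) z - prox \<sigma> (conjugate f) z')) \<bullet> (prox \<sigma> (conjugate f) z - prox \<sigma> (conjugate f) z')"
proof -
  obtain x0 where x0: "f x0 \<noteq> \<infinity>" using f by blast
  then have "\<bar>f x0\<bar> \<noteq> \<infinity>" using f(1)[of x0] by (cases "f x0") auto
  moreover obtain y0 where "conjugate f y0 \<noteq> \<infinity>" using conjugate_finite[OF f(3,2,1) x0] by blast
  ultimately show ?thesis
    using f \<omega>\<^sub>f steps by (intro prox_strongly_monotone[where ?x0.0 = y0] lsc_conjugate conjugate_not_MInf) auto
qed

lemma prox_primal:
  "\<tau> * \<omega>\<^sub>g * (norm (prox \<tau> g z - prox \<tau> g z'))\<^sup>2
    \<le> ((z - z') - (prox \<tau> g z - prox \<tau> g z')) \<bullet> (prox \<tau> g z - prox \<tau> g z')"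
proof -
  obtain x0 where x0: "g x0 \<noteq> \<infinity>" using g by blast
  then show ?thesis
    using g \<omega>\<^sub>g steps by (intro prox_strongly_monotone[where ?x0.0 = x0]) auto
qed

lemma continuous_prox_dual: "continuous_on UNIV (prox \<sigma> (conjugate f))"
  by (rule continuous_if_firmly_nonexpansive, rule order_trans[OF _ prox_dual]) (use steps \<omega>\<^sub>f in simp)

lemma continuous_prox_primal: "continuous_on UNIV (prox \<tau> g)"
  by (rule continuous_if_firmly_nonexpansive, rule order_trans[OF _ prox_primal]) (use steps \<omega>\<^sub>g in simp)

lemma continuous_step: "continuous_on UNIV (\<lambda>p. step (fst p) (snd p))"
proof -
  note [continuous_intros] =
    continuous_on_compose2[OF continuous_prox_dual] continuous_on_compose2[OF continuous_prox_primal]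
    continuous_on_compose2[OF continuous_linear[OF K, of UNIV]]
    continuous_on_compose2[OF continuous_linear[OF adjoint_linear[OF K], of UNIV]]
  show ?thesis unfolding pd_step_def case_prod_unfold Let_def
    by (intro continuous_intros) auto
qed

lemma continuous_V: "continuous_on UNIV V"
proof -
  note [continuous_intros] = continuous_on_compose2[OF continuous_linear[OF K, of UNIV]]
  show ?thesis unfolding pd_lyapunov_def case_prod_unfold Let_def
    by (intro continuous_intros) (use steps in auto)
qed

text \<open>The noise enters both states by the same summand and drops out of the difference.\<close>

lemma V_step: "V (step s e - step s' e) \<le> \<theta> * V (s - s')"
proof -
  obtain x z y where s: "s = (x, z, y)" by (cases s)
  obtain x' z' y' where s': "s' = (x', z', y')" by (cases s')
  define \<eta> \<eta>' where "\<eta> = prox \<sigma> (conjugate f) (y + \<sigma> *\<^sub>R K z)" and "\<eta>' = prox \<sigma> (conjugate f) (y' + \<sigma> *\<^sub>R K z')"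
  define p p' where "p = prox \<tau> g (x - \<tau> *\<^sub>R adjoint K \<eta>)" and "p' = prox \<tau> g (x' - \<tau> *\<^sub>R adjoint K \<eta>')"
  have "\<sigma> * \<omega>\<^sub>f * (norm (\<eta> - \<eta>'))\<^sup>2 \<le> (((y - y') + \<sigma> *\<^sub>R K (z - z')) - (\<eta> - \<eta>')) \<bullet> (\<eta> - \<eta>')"
    using prox_dual[of "y + \<sigma> *\<^sub>R K z" "y' + \<sigma> *\<^sub>R K z'"]
    by (simp add: \<eta>_def \<eta>'_def linear_diff[OF K] algebra_simps)
  moreover have "\<tau> * \<omega>\<^sub>g * (norm (p - p'))\<^sup>2 \<le> (((x - x') - \<tau> *\<^sub>R adjoint K (\<eta> - \<eta>')) - (p - p')) \<bullet> (p - p')"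
    using prox_primal[of "x - \<tau> *\<^sub>R adjoint K \<eta>" "x' - \<tau> *\<^sub>R adjoint K \<eta>'"]
    by (simp add: p_def p'_def linear_diff[OF adjoint_linear[OF K]] algebra_simps)
  ultimately have "V (p - p', (p - p') + \<theta> *\<^sub>R ((p - p') - (x - x')), \<eta> - \<eta>') \<le> \<theta> * V (x - x', z - z', y - y')"
    by (intro pd_lyapunov_contraction K steps \<theta>_pos \<theta>_ge coupling_const)
  moreover have "step s e - step s' e = (p - p', (p - p') + \<theta> *\<^sub>R ((p - p') - (x - x')), \<eta> - \<eta>')"
    by (simp add: s s' pd_step_def Let_def \<eta>_def[symmetric] \<eta>'_def[symmetric] p_def[symmetric] p'_def[symmetric] algebra_simps)
  ultimately show ?thesis by (simp add: s s')
qed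

sublocale contractive_random_map step std_gaussian V \<theta>
proof -
  have "prob_space (std_gaussian :: (real^'d) measure)" by (rule prob_space_std_gaussian)
  moreover have "(\<lambda>(s, e). step s e) \<in> borel_measurable (borel \<Otimes>\<^sub>M borel)"
    unfolding case_prod_unfold borel_prod by (intro borel_measurable_continuous_onI continuous_step)
  ultimately show "contractive_random_map step std_gaussian V \<theta>"
    using V_step \<theta>_pos
    by (intro contractive_random_map.intro random_map.intro random_map_axioms.intro contractive_random_map_axioms.intro
        borel_measurable_continuous_onI continuous_V) auto
qed

text \<open>The chain starts with \<open>X\<^sub>\<theta>\<^sup>0 = X\<^sup>0\<close>, so an initial law of pairs determines one of full states.\<close>

definition embed :: "(real^'d) \<times> (real^'m) \<Rightarrow> (real^'d) \<times> (real^'d) \<times> (real^'m)" where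
  "embed = (\<lambda>(x, y). (x, x, y))"

definition observe :: "(real^'d) \<times> (real^'d) \<times> (real^'m) \<Rightarrow> (real^'d) \<times> (real^'m)" where
  "observe = (\<lambda>(x, x\<^sub>\<theta>, y). (x, y))"

lemma measurable_embed [measurable]: "embed \<in> borel_measurable borel"
  unfolding embed_def case_prod_unfold by (intro borel_measurable_continuous_onI continuous_intros)

lemma measurable_observe [measurable]: "observe \<in> borel_measurable borel"
  unfolding observe_def case_prod_unfold by (intro borel_measurable_continuous_onI continuous_intros)

text \<open>With \<open>x\<^sub>\<theta> = x\<close> the increment and the cross term vanish, and \<open>V\<close> reduces to a multiple of the transport cost.\<close>

lemma V_embed: "V (embed p - embed p') = a / \<tau> * ((norm (fst p - fst p'))\<^sup>2 + weight * (norm (snd p - snd p'))\<^sup>2)"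
proof -
  have "a / \<tau> * weight = b / \<sigma>" using ab steps by simp
  then have w: "a / \<tau> * (weight * r) = b / \<sigma> * r" for r by (metis mult.assoc)
  have "V (embed p - embed p') = a / \<tau> * (norm (fst p - fst p'))\<^sup>2 + b / \<sigma> * (norm (snd p - snd p'))\<^sup>2"
    by (simp add: embed_def case_prod_unfold pd_lyapunov_def Let_def linear_0[OF K])
  then show ?thesis unfolding distrib_left w .
qed

lemma V_primal: "(norm (fst s - fst s'))\<^sup>2 \<le> \<tau> / a * V (s - s')"
proof -
  obtain x z y where d: "s - s' = (x, z, y)" by (cases "s - s'")
  have "a / \<tau> * (norm x)\<^sup>2 \<le> a / \<tau> * (norm x)\<^sup>2 + (1 - q) * (b / \<sigma> * (norm y)\<^sup>2)"
    using coupling_const ab steps by simp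
  also have "\<dots> \<le> V (x, z, y)" by (rule pd_lyapunov_lower_dual[OF K steps \<theta>_pos \<theta>_ge(2)])
  finally have "\<tau> / a * (a / \<tau> * (norm x)\<^sup>2) \<le> \<tau> / a * V (x, z, y)"
    using ab steps by (intro mult_left_mono) auto
  moreover have "fst s - fst s' = x" using d by (metis fst_conv fst_diff)
  ultimately show ?thesis using ab steps d by simp
qed

lemma V_primal_dual:
  assumes "q < 1"
  shows "(norm (fst (observe s) - fst (observe s')))\<^sup>2 + weight * (norm (snd (observe s) - snd (observe s')))\<^sup>2
    \<le> \<tau> / a / (1 - q) * V (s - s')"
proof -
  obtain x z y where d: "s - s' = (x, z, y)" by (cases "s - s'")
  have q0: "0 \<le> q" using steps \<theta>_pos by simp
  have "(1 - q) * (a / \<tau> * (norm x)\<^sup>2) \<le> a / \<tau> * (norm x)\<^sup>2"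
    using ab steps assms q0 by (intro mult_left_le_one_le) auto
  then have "(1 - q) * (a / \<tau> * (norm x)\<^sup>2 + b / \<sigma> * (norm y)\<^sup>2) \<le> V (x, z, y)"
    using pd_lyapunov_lower_dual[OF K steps \<theta>_pos \<theta>_ge(2), of a x y z] unfolding distrib_left by linarith
  then have "a / \<tau> * (norm x)\<^sup>2 + b / \<sigma> * (norm y)\<^sup>2 \<le> V (x, z, y) / (1 - q)"
    using assms by (simp add: pos_le_divide_eq mult.commute)
  then have "\<tau> / a * (a / \<tau> * (norm x)\<^sup>2 + b / \<sigma> * (norm y)\<^sup>2) \<le> \<tau> / a * (V (x, z, y) / (1 - q))"
    using ab steps by (intro mult_left_mono) auto
  moreover have "\<tau> / a * (a / \<tau> * (norm x)\<^sup>2 + b / \<sigma> * (norm y)\<^sup>2) = (norm x)\<^sup>2 + weight * (norm y)\<^sup>2"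
    using ab steps by (simp add: distrib_left)
  moreover have "fst (observe s) - fst (observe s') = x" "snd (observe s) - snd (observe s') = y"
    using d by (auto simp: observe_def case_prod_unfold minus_prod_def)
  ultimately show ?thesis using d by simp
qed

text \<open>The auxiliary variable \<open>Z\<close> allows the inputs to be independent of more than the initial value of this chain, as
is the case when two chains share them.\<close>

lemma langevin_law:
  fixes Z :: "'w \<Rightarrow> 'z::topological_space"
  assumes M: "prob_space M" and pd: "pd_langevin K f g \<tau> \<sigma> \<theta> M \<xi> \<pi>\<^sub>0 X X\<^sub>\<theta> Y"
    and inputs: "gaussian_inputs M \<xi> Z" and Z: "Z \<in> borel_measurable M"
    and h: "h \<in> borel_measurable borel" "\<And>w. w \<in> space M \<Longrightarrow> (X 0 w, Y 0 w) = h (Z w)"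
  shows "distr M borel (X n) = distr ((push step std_gaussian ^^ n) (distr \<pi>\<^sub>0 borel embed)) borel fst"
    and "distr M borel (\<lambda>w. (X n w, Y n w)) = distr ((push step std_gaussian ^^ n) (distr \<pi>\<^sub>0 borel embed)) borel observe"
proof -
  define S where "S n w = (X n w, X\<^sub>\<theta> n w, Y n w)" for n w
  have init: "distr M borel (\<lambda>w. (X 0 w, Y 0 w)) = \<pi>\<^sub>0" and X\<theta>: "\<And>w. w \<in> space M \<Longrightarrow> X\<^sub>\<theta> 0 w = X 0 w"
    and orbit: "\<And>n w. w \<in> space M \<Longrightarrow> S (Suc n) w = step (S n w) (\<xi> (Suc n) w)"
    using pd by (auto simp: pd_langevin_def S_def)
  have S0: "S 0 w = embed (h (Z w))" if "w \<in> space M" for w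
    using h(2)[OF that, symmetric] X\<theta>[OF that] by (simp add: S_def embed_def)
  have eh: "(\<lambda>z. embed (h z)) \<in> borel_measurable borel" using h(1) by measurable
  have m0: "S 0 \<in> borel_measurable M"
    using measurable_compose[OF Z eh] by (subst measurable_cong[OF S0])
  note ind = gaussian_inputs_independent[OF M inputs Z eh]
  have "distr M (borel \<Otimes>\<^sub>M stream_space std_gaussian) (\<lambda>w. (S 0 w, to_stream (\<lambda>n. \<xi> (Suc n) w)))
      = distr M (borel \<Otimes>\<^sub>M stream_space std_gaussian) (\<lambda>w. (embed (h (Z w)), to_stream (\<lambda>n. \<xi> (Suc n) w)))"
    by (intro distr_cong) (auto simp: S0)
  also have "\<dots> = distr M borel (\<lambda>w. embed (h (Z w))) \<Otimes>\<^sub>M stream_space std_gaussian" by (rule ind(2))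
  also have "distr M borel (\<lambda>w. embed (h (Z w))) = distr M borel (S 0)"
    by (intro distr_cong) (auto simp: S0)
  finally have indep: "distr M (borel \<Otimes>\<^sub>M stream_space std_gaussian) (\<lambda>w. (S 0 w, to_stream (\<lambda>n. \<xi> (Suc n) w)))
      = distr M borel (S 0) \<Otimes>\<^sub>M stream_space std_gaussian" .
  have meas [measurable]: "S n \<in> borel_measurable M"
    and law: "distr M borel (S n) = (push step std_gaussian ^^ n) (distr M borel (S 0))" for n
    by (rule distr_orbit[where S = S and \<xi> = \<xi>, OF M m0 ind(1) orbit indep]; assumption)+
  have hZ: "(\<lambda>w. h (Z w)) \<in> borel_measurable M" by (rule measurable_compose[OF Z h(1)])
  have "distr M borel (S 0) = distr M borel (\<lambda>w. embed (h (Z w)))" by (intro distr_cong) (auto simp: S0)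
  also have "\<dots> = distr (distr M borel (\<lambda>w. h (Z w))) borel embed"
    using hZ by (simp add: distr_distr comp_def)
  also have "distr M borel (\<lambda>w. h (Z w)) = \<pi>\<^sub>0"
    unfolding init[symmetric] by (intro distr_cong) (auto simp: h(2))
  finally have law0: "distr M borel (S 0) = distr \<pi>\<^sub>0 borel embed" .
  show "distr M borel (X n) = distr ((push step std_gaussian ^^ n) (distr \<pi>\<^sub>0 borel embed)) borel fst"
    unfolding law0[symmetric] law[symmetric] distr_distr[OF borel_fst meas] by (simp add: comp_def S_def)
  show "distr M borel (\<lambda>w. (X n w, Y n w)) = distr ((push step std_gaussian ^^ n) (distr \<pi>\<^sub>0 borel embed)) borel observe"
    unfolding law0[symmetric] law[symmetric] distr_distr[OF measurable_observe meas] by (simp add: comp_def S_def observe_def)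
qed

lemma primal_cost_measurable: "(\<lambda>(x, x'). ennreal ((dist x x')\<^sup>2)) \<in> borel_measurable (borel :: ((real^'d) \<times> (real^'d)) measure)"
  unfolding case_prod_unfold by (intro measurable_compose[OF _ measurable_ennreal] borel_measurable_continuous_onI continuous_intros)

lemma primal_dual_cost_measurable:
  "(\<lambda>(p, p'). ennreal (1 * (norm (fst p - fst p'))\<^sup>2 + weight * (norm (snd p - snd p'))\<^sup>2))
     \<in> borel_measurable (borel :: (((real^'d) \<times> (real^'m)) \<times> ((real^'d) \<times> (real^'m))) measure)"
  unfolding case_prod_unfold by (intro measurable_compose[OF _ measurable_ennreal] borel_measurable_continuous_onI continuous_intros)

lemma primal_bound:
  assumes "\<Gamma> \<in> couplings \<rho> \<rho>'"
  shows "wasserstein2 (distr ((push step std_gaussian ^^ n) \<rho>) borel fst) (distr ((push step std_gaussian ^^ n) \<rho>') borel fst)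
    \<le> ennreal (sqrt (\<tau> / a * \<theta> ^ n)) * esqrt (\<integral>\<^sup>+(s, s'). ennreal (V (s - s')) \<partial>\<Gamma>)"
  unfolding wasserstein2_def using V_primal ab steps
  by (intro transport_cost_le[OF assms] borel_fst primal_cost_measurable) (auto simp: dist_norm)

lemma primal_dual_bound:
  assumes "\<Gamma> \<in> couplings \<rho> \<rho>'" "q < 1"
  shows "transport 1 weight (distr ((push step std_gaussian ^^ n) \<rho>) borel observe) (distr ((push step std_gaussian ^^ n) \<rho>') borel observe)
    \<le> ennreal (sqrt (\<tau> / a / (1 - q) * \<theta> ^ n)) * esqrt (\<integral>\<^sup>+(s, s'). ennreal (V (s - s')) \<partial>\<Gamma>)"
  unfolding transport_eq using V_primal_dual[OF assms(2)] ab steps assms(2)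
  by (intro transport_cost_le[OF assms(1)] measurable_observe primal_dual_cost_measurable) auto

lemma embed_coupling_cost:
  assumes \<gamma>: "\<gamma> \<in> couplings \<pi> \<pi>'"
  shows "esqrt (\<integral>\<^sup>+(s, s'). ennreal (V (s - s')) \<partial>distr \<gamma> borel (\<lambda>(p, p'). (embed p, embed p')))
    = ennreal (sqrt (a / \<tau>)) * esqrt (\<integral>\<^sup>+(p, p'). ennreal (1 * (norm (fst p - fst p'))\<^sup>2 + weight * (norm (snd p - snd p'))\<^sup>2) \<partial>\<gamma>)"
proof -
  have sets: "sets \<gamma> = sets borel" using \<gamma> by (simp add: couplings_def space_prob_algebra)
  have m: "(\<lambda>(p, p'). (embed p, embed p')) \<in> borel_measurable \<gamma>"
  proof -
    have "(\<lambda>(p, p'). (embed p, embed p')) \<in> borel_measurable borel"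
      unfolding case_prod_unfold embed_def by (intro borel_measurable_continuous_onI continuous_intros)
    then show ?thesis using sets by (simp cong: measurable_cong_sets)
  qed
  have V: "(\<lambda>(s, s'). ennreal (V (s - s'))) \<in> borel_measurable borel"
    unfolding case_prod_unfold
    by (intro measurable_compose[OF _ measurable_ennreal] borel_measurable_continuous_onI
        continuous_on_compose2[OF continuous_V] continuous_intros) auto
  have "(\<integral>\<^sup>+(s, s'). ennreal (V (s - s')) \<partial>distr \<gamma> borel (\<lambda>(p, p'). (embed p, embed p')))
      = (\<integral>\<^sup>+(p, p'). ennreal (V (embed p - embed p')) \<partial>\<gamma>)"
    by (subst nn_integral_distr[OF m]) (use V in \<open>auto simp: case_prod_unfold\<close>)
  also have "\<dots> = (\<integral>\<^sup>+pp. ennreal (a / \<tau>) * (case pp of (p, p') \<Rightarrow> ennreal (1 * (norm (fst p - fst p'))\<^sup>2 + weight * (norm (snd p - snd p'))\<^sup>2)) \<partial>\<gamma>)"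
    using ab steps by (intro nn_integral_cong) (auto simp: V_embed ennreal_mult' simp del: times_divide_eq_left times_divide_eq_right)
  also have "\<dots> = ennreal (a / \<tau>) * (\<integral>\<^sup>+(p, p'). ennreal (1 * (norm (fst p - fst p'))\<^sup>2 + weight * (norm (snd p - snd p'))\<^sup>2) \<partial>\<gamma>)"
    using primal_dual_cost_measurable sets by (intro nn_integral_cmult) (simp cong: measurable_cong_sets)
  finally show ?thesis using ab steps by (simp add: esqrt_cmult del: times_divide_eq_left times_divide_eq_right)
qed

text \<open>The rate \<open>\<theta>\<^sup>n\<close> is one for squared distances, hence the exponent \<open>n / 2\<close>.\<close>

lemma sqrt_rate: "0 \<le> k \<Longrightarrow> sqrt (k * \<theta> ^ n) = sqrt k * \<theta> powr (real n / 2)"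
  using \<theta>_pos by (simp add: real_sqrt_mult powr_half_sqrt[symmetric] powr_realpow[symmetric] powr_powr)

lemma primal_contraction:
  "wasserstein2 (distr ((push step std_gaussian ^^ n) (distr \<pi> borel embed)) borel fst)
      (distr ((push step std_gaussian ^^ n) (distr \<pi>' borel embed)) borel fst)
    \<le> ennreal (\<theta> powr (real n / 2)) * transport 1 weight \<pi> \<pi>'"
  unfolding transport_eq
proof (rule le_cmult_INF)
  show "0 < \<theta> powr (real n / 2)" using \<theta>_pos by simp
  fix \<gamma> assume \<gamma>: "\<gamma> \<in> couplings \<pi> \<pi>'"
  have k: "sqrt (\<tau> / a * \<theta> ^ n) * sqrt (a / \<tau>) = \<theta> powr (real n / 2)"
  proof -
    have "sqrt (\<tau> / a) * sqrt (a / \<tau>) = 1" using ab steps by (simp add: real_sqrt_mult[symmetric])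
    then show ?thesis using ab steps sqrt_rate[of "\<tau> / a" n] by (simp add: mult_ac)
  qed
  show "wasserstein2 (distr ((push step std_gaussian ^^ n) (distr \<pi> borel embed)) borel fst)
      (distr ((push step std_gaussian ^^ n) (distr \<pi>' borel embed)) borel fst)
    \<le> ennreal (\<theta> powr (real n / 2)) * esqrt (\<integral>\<^sup>+(p, p'). ennreal (1 * (norm (fst p - fst p'))\<^sup>2 + weight * (norm (snd p - snd p'))\<^sup>2) \<partial>\<gamma>)"
    using primal_bound[OF couplings_distr[OF \<gamma> measurable_embed], of n] ab steps \<theta>_pos
    unfolding embed_coupling_cost[OF \<gamma>] k[symmetric] by (simp add: ennreal_mult mult.assoc)
qed

lemma primal_dual_contraction:
  assumes "q < 1"
  shows "transport 1 weight (distr ((push step std_gaussian ^^ n) (distr \<pi> borel embed)) borel observe)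
      (distr ((push step std_gaussian ^^ n) (distr \<pi>' borel embed)) borel observe)
    \<le> ennreal (1 / sqrt (1 - q) * \<theta> powr (real n / 2)) * transport 1 weight \<pi> \<pi>'"
  unfolding transport_eq[of 1 weight \<pi> \<pi>']
proof (rule le_cmult_INF)
  show "0 < 1 / sqrt (1 - q) * \<theta> powr (real n / 2)" using \<theta>_pos assms by simp
  fix \<gamma> assume \<gamma>: "\<gamma> \<in> couplings \<pi> \<pi>'"
  have k: "sqrt (\<tau> / a / (1 - q) * \<theta> ^ n) * sqrt (a / \<tau>) = 1 / sqrt (1 - q) * \<theta> powr (real n / 2)"
  proof -
    have "sqrt (\<tau> / a) * sqrt (a / \<tau>) = 1" using ab steps by (simp add: real_sqrt_mult[symmetric])
    then have "sqrt (\<tau> / a / (1 - q)) * sqrt (a / \<tau>) = 1 / sqrt (1 - q)"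
      unfolding real_sqrt_divide[of "\<tau> / a"] by simp
    then show ?thesis using ab steps assms sqrt_rate[of "\<tau> / a / (1 - q)" n] by (simp add: mult_ac)
  qed
  show "transport 1 weight (distr ((push step std_gaussian ^^ n) (distr \<pi> borel embed)) borel observe)
      (distr ((push step std_gaussian ^^ n) (distr \<pi>' borel embed)) borel observe)
    \<le> ennreal (1 / sqrt (1 - q) * \<theta> powr (real n / 2)) * esqrt (\<integral>\<^sup>+(p, p'). ennreal (1 * (norm (fst p - fst p'))\<^sup>2 + weight * (norm (snd p - snd p'))\<^sup>2) \<partial>\<gamma>)"
    using primal_dual_bound[OF couplings_distr[OF \<gamma> measurable_embed] assms, of n] ab steps \<theta>_pos assms
    unfolding embed_coupling_cost[OF \<gamma>] k[symmetric] by (simp add: ennreal_mult mult.assoc)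
qed

text \<open>The step is affine in the noise, with slope \<open>\<surd>(2\<tau>)\<close> in the primal and \<open>(1 + \<theta>) \<surd>(2\<tau>)\<close> in the extrapolated
component.\<close>

lemma step_second_moment: "(\<integral>\<^sup>+e. ennreal ((norm (step 0 e))\<^sup>2) \<partial>std_gaussian) < \<top>"
proof -
  let ?c = "sqrt (2 * \<tau>)"
  define B where "B = ?c\<^sup>2 + ((1 + \<theta>) * ?c)\<^sup>2"
  define A where "A = (norm (step 0 0))\<^sup>2"
  have bound: "(norm (step 0 e))\<^sup>2 \<le> 2 * A + 2 * B * (norm e)\<^sup>2" for e
  proof -
    let ?d = "(?c *\<^sub>R e, ((1 + \<theta>) * ?c) *\<^sub>R e, 0 :: real^'m)"
    have "step 0 e = step 0 0 + ?d"
      by (simp add: pd_step_def zero_prod_def Let_def algebra_simps)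
    then have "(norm (step 0 e))\<^sup>2 \<le> (norm (step 0 0) + norm ?d)\<^sup>2"
      by (intro power_mono) (simp_all add: norm_triangle_ineq)
    also have "\<dots> \<le> 2 * (norm (step 0 0))\<^sup>2 + 2 * (norm ?d)\<^sup>2"
      using zero_le_power2[of "norm (step 0 0) - norm ?d"] by (simp add: power2_eq_square algebra_simps)
    also have "(norm ?d)\<^sup>2 = B * (norm e)\<^sup>2" by (simp add: norm_Pair B_def power_mult_distrib distrib_right)
    finally show ?thesis by (simp add: A_def)
  qed
  have B0: "0 \<le> B" by (simp add: B_def)
  have "(\<integral>\<^sup>+e. ennreal ((norm (step 0 e))\<^sup>2) \<partial>std_gaussian)
      \<le> (\<integral>\<^sup>+e. ennreal (2 * A) + ennreal (2 * B) * ennreal ((norm e)\<^sup>2) \<partial>(std_gaussian :: (real^'d) measure))"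
    using bound B0 by (intro nn_integral_mono)
      (simp add: A_def ennreal_mult[symmetric] ennreal_plus[symmetric] ennreal_leI del: ennreal_plus)
  also have "\<dots> = ennreal (2 * A) + ennreal (2 * B) * (\<integral>\<^sup>+e. ennreal ((norm e)\<^sup>2) \<partial>(std_gaussian :: (real^'d) measure))"
    by (subst nn_integral_add) (auto simp: nn_integral_cmult emeasure_space_1[simplified])
  also have "\<dots> < \<top>" using std_gaussian_second_moment[where 'd = 'd] by (simp add: ennreal_mult_less_top)
  finally show ?thesis .
qed

lemma invariant_law:
  assumes "q < 1"
  shows "\<exists>\<rho>\<in>P2. push step std_gaussian \<rho> = \<rho>"
proof -
  obtain c where c: "0 < c" "\<And>s. c * (norm s)\<^sup>2 \<le> V s"
    using pd_lyapunov_coercive[OF K steps \<theta>_pos \<theta>_ge \<theta>_less assms] by blast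
  obtain C where C: "0 \<le> C" "\<And>s. V s \<le> C * (norm s)\<^sup>2"
    using pd_lyapunov_bounded[OF K steps \<theta>_pos, of a b] ab by auto
  have "continuous_on UNIV (\<lambda>s. step s e)" for e
  proof -
    have "continuous_on UNIV (\<lambda>s. (s, e))" by (intro continuous_intros)
    from continuous_on_compose2[OF continuous_step this] show ?thesis by simp
  qed
  from invariant_law_exists[OF \<theta>_less c C this step_second_moment] show ?thesis .
qed

lemma embed_P2: "\<pi> \<in> P2 \<Longrightarrow> distr \<pi> borel embed \<in> P2"
  by (rule P2_distr[where k = 2]) (auto simp: embed_def case_prod_unfold norm_Pair norm_prod_def)

lemma observe_P2: "\<rho> \<in> P2 \<Longrightarrow> distr \<rho> borel observe \<in> P2"
  by (rule P2_distr[where k = 1]) (auto simp: observe_def case_prod_unfold norm_Pair norm_prod_def)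

text \<open>Start from the independent coupling of \<open>\<mu>\<close> and \<open>\<rho>\<close>: its cost is finite because both laws have a finite second
moment, and \<open>\<rho>\<close> does not move.\<close>

lemma converges_to_invariant_law:
  assumes q: "q < 1" and \<rho>: "\<rho> \<in> P2" "push step std_gaussian \<rho> = \<rho>" and \<mu>: "\<mu> \<in> P2"
  shows "(\<lambda>n. transport 1 weight (distr ((push step std_gaussian ^^ n) \<mu>) borel observe) (distr \<rho> borel observe)) \<longlonglongrightarrow> 0"
proof -
  have p: "\<mu> \<in> space (prob_algebra borel)" "\<rho> \<in> space (prob_algebra borel)" using \<mu> \<rho> by (auto simp: P2_def)
  have inv: "(push step std_gaussian ^^ n) \<rho> = \<rho>" for n by (induction n) (simp_all add: \<rho>)
  obtain C where C: "0 \<le> C" "\<And>s. V s \<le> C * (norm s)\<^sup>2"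
    using pd_lyapunov_bounded[OF K steps \<theta>_pos, of a b] ab by auto
  define E where "E = (\<integral>\<^sup>+(s, s'). ennreal (V (s - s')) \<partial>(\<mu> \<Otimes>\<^sub>M \<rho>))"
  have "sets (\<mu> \<Otimes>\<^sub>M \<rho>) = sets borel"
    using pair_measure_coupling[OF p] by (simp add: couplings_def space_prob_algebra)
  then have m: "(\<lambda>(s, s'). ennreal ((norm (s - s'))\<^sup>2)) \<in> borel_measurable (\<mu> \<Otimes>\<^sub>M \<rho>)"
    unfolding case_prod_unfold
    by (simp cong: measurable_cong_sets)
  have "E \<le> (\<integral>\<^sup>+p. ennreal C * (case p of (s, s') \<Rightarrow> ennreal ((norm (s - s'))\<^sup>2)) \<partial>(\<mu> \<Otimes>\<^sub>M \<rho>))"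
    unfolding E_def using C by (intro nn_integral_mono) (auto simp: ennreal_mult[symmetric] intro!: ennreal_leI)
  also have "\<dots> = ennreal C * (\<integral>\<^sup>+(s, s'). ennreal ((norm (s - s'))\<^sup>2) \<partial>(\<mu> \<Otimes>\<^sub>M \<rho>))"
    by (rule nn_integral_cmult[OF m])
  also have "\<dots> < \<top>" using P2_pair_sq_dist_finite[OF \<mu> \<rho>(1)] by (simp add: ennreal_mult_less_top)
  finally have E: "esqrt E = ennreal (sqrt (enn2real E))" by (simp add: esqrt_def)
  let ?k = "sqrt (\<tau> / a / (1 - q))" and ?e = "sqrt (enn2real E)"
  have le: "transport 1 weight (distr ((push step std_gaussian ^^ n) \<mu>) borel observe) (distr \<rho> borel observe)
      \<le> ennreal (?k * ?e * sqrt \<theta> ^ n)" for n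
  proof -
    let ?r = "sqrt (\<tau> / a / (1 - q) * \<theta> ^ n)"
    have "transport 1 weight (distr ((push step std_gaussian ^^ n) \<mu>) borel observe) (distr \<rho> borel observe)
        \<le> ennreal ?r * ennreal ?e"
      using primal_dual_bound[OF pair_measure_coupling[OF p] q, of n] unfolding inv E_def[symmetric] E .
    also have "\<dots> = ennreal (?r * ?e)" by (rule ennreal_mult''[symmetric]) simp
    also have "?r * ?e = ?k * ?e * sqrt \<theta> ^ n" by (simp only: real_sqrt_mult real_sqrt_power mult_ac)
    finally show ?thesis .
  qed
  have "(\<lambda>n. ?k * ?e * sqrt \<theta> ^ n) \<longlonglongrightarrow> ?k * ?e * 0"
    using \<theta>_pos \<theta>_less by (intro tendsto_intros LIMSEQ_realpow_zero) auto
  then have "(\<lambda>n. ennreal (?k * ?e * sqrt \<theta> ^ n)) \<longlonglongrightarrow> ennreal 0" by (intro tendsto_ennrealI) simp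
  then have "(\<lambda>n. ennreal (?k * ?e * sqrt \<theta> ^ n)) \<longlonglongrightarrow> 0" by simp
  then show ?thesis
    by (rule tendsto_sandwich[OF _ _ tendsto_const, rotated 2]) (intro always_eventually allI le zero_le)+
qed

end

section \<open>The contraction theorem\<close>

theorem theorem4p2:
  fixes K :: "real^'d \<Rightarrow> real^'m"
    and f :: "real^'m \<Rightarrow> ereal" and g :: "real^'d \<Rightarrow> ereal"
    and \<omega>\<^sub>g \<omega>\<^sub>f \<tau> \<sigma> \<theta> L lam lam' C :: real
  assumes "linear K"
    and "\<forall>y. f y \<noteq> -\<infinity>" "econvex f" "lsc f"
    and "\<forall>x. g x \<noteq> -\<infinity>" "econvex g" "lsc g"
    and "0 < (\<integral>\<^sup>+ x. eexp (- f (K x) - g x) \<partial>lborel)"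
    and "(\<integral>\<^sup>+ x. eexp (- f (K x) - g x) \<partial>lborel) < \<top>"
    and "\<omega>\<^sub>g > 0" "strongly_econvex \<omega>\<^sub>g g"
    and "\<omega>\<^sub>f > 0" "strongly_econvex \<omega>\<^sub>f (conjugate f)"
    and "\<tau> > 0" "\<sigma> > 0"
    and "lam = \<sigma> / \<tau>"
    and "L = onorm K"
    and "max (1 / (1 + 2 * \<omega>\<^sub>g * \<tau>)) (1 / (1 + 2 * \<omega>\<^sub>f * \<sigma>)) \<le> \<theta>" "\<theta> < 1"
    and "\<theta> * \<sigma> * \<tau> * L\<^sup>2 \<le> 1"
    and "lam' = (1 + 2 * \<omega>\<^sub>g * \<tau>) / (1 + 2 * \<omega>\<^sub>f * \<sigma>) * lam"
    and "C = 1 / sqrt (1 - \<theta> * \<tau> * \<sigma> * L\<^sup>2)"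
  shows
    "(\<forall>(M :: 'w measure) \<xi> \<pi>\<^sub>0 \<pi>\<^sub>0' X X\<^sub>\<theta> Y X' X\<^sub>\<theta>' Y'.
        prob_space M \<and> \<pi>\<^sub>0 \<in> P2 \<and> \<pi>\<^sub>0' \<in> P2 \<and>
        pd_langevin K f g \<tau> \<sigma> \<theta> M \<xi> \<pi>\<^sub>0 X X\<^sub>\<theta> Y \<and>
        pd_langevin K f g \<tau> \<sigma> \<theta> M \<xi> \<pi>\<^sub>0' X' X\<^sub>\<theta>' Y' \<and>
        gaussian_inputs M \<xi> (\<lambda>w. (X 0 w, Y 0 w, X' 0 w, Y' 0 w))
        \<longrightarrow>
        (\<forall>N. wasserstein2 (distr M borel (X N)) (distr M borel (X' N))
               \<le> ennreal (\<theta> powr (real N / 2)) * transport 1 (1 / lam') \<pi>\<^sub>0 \<pi>\<^sub>0') \<and>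
        (\<theta> * \<sigma> * \<tau> * L\<^sup>2 < 1 \<longrightarrow>
          (\<forall>N. transport 1 (1 / lam') (distr M borel (\<lambda>w. (X N w, Y N w)))
                                      (distr M borel (\<lambda>w. (X' N w, Y' N w)))
                 \<le> ennreal (C * \<theta> powr (real N / 2)) * transport 1 (1 / lam') \<pi>\<^sub>0 \<pi>\<^sub>0')))
     \<and>
     (\<theta> * \<sigma> * \<tau> * L\<^sup>2 < 1 \<longrightarrow>
        (\<exists>\<pi>\<in>P2. pd_stationary K f g \<tau> \<sigma> \<theta> \<pi> \<and>
          (\<forall>(M :: 'w measure) \<xi> \<pi>\<^sub>0 X X\<^sub>\<theta> Y.
             prob_space M \<and> \<pi>\<^sub>0 \<in> P2 \<and>
             pd_langevin K f g \<tau> \<sigma> \<theta> M \<xi> \<pi>\<^sub>0 X X\<^sub>\<theta> Y \<and>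
             gaussian_inputs M \<xi> (\<lambda>w. (X 0 w, Y 0 w))
             \<longrightarrow>
             (\<lambda>N. transport 1 (1 / lam') (distr M borel (\<lambda>w. (X N w, Y N w))) \<pi>)
               \<longlonglongrightarrow> 0)))"
proof -
  have proper: "\<exists>x. f (K x) \<noteq> \<infinity> \<and> g x \<noteq> \<infinity>"
  proof (rule ccontr)
    assume "\<not> ?thesis"
    then have inf: "f (K x) = \<infinity> \<or> g x = \<infinity>" for x by blast
    have "eexp (- f (K x) - g x) = 0" for x
      using assms(2)[rule_format, of "K x"] assms(5)[rule_format, of x] inf[of x]
      by (cases "f (K x)"; cases "g x") (auto simp: eexp_def)
    with assms(8) show False by simp
  qed
  have inverse_le: "1 \<le> \<theta> * r" if "1 / r \<le> \<theta>" "0 < r" for r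
    using that by (simp add: pos_divide_le_eq)
  interpret primal_dual K f g \<omega>\<^sub>g \<omega>\<^sub>f \<tau> \<sigma> \<theta>
  proof (rule primal_dual.intro)
    have "1 / (1 + 2 * \<omega>\<^sub>g * \<tau>) \<le> \<theta>" "1 / (1 + 2 * \<omega>\<^sub>f * \<sigma>) \<le> \<theta>" using assms(18) by auto
    moreover have "0 < 1 + 2 * \<omega>\<^sub>g * \<tau>" "0 < 1 + 2 * \<omega>\<^sub>f * \<sigma>"
      using assms by (auto intro!: add_pos_pos)
    ultimately show "1 \<le> \<theta> * (1 + 2 * \<omega>\<^sub>g * \<tau>)" "1 \<le> \<theta> * (1 + 2 * \<omega>\<^sub>f * \<sigma>)"
      by (auto intro!: inverse_le)
    show "\<exists>y. f y \<noteq> \<infinity>" "\<exists>x. g x \<noteq> \<infinity>" using proper by auto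
  qed (use assms in auto)
  have weight: "1 / lam' = weight" using assms(16,21) by simp
  have q: "\<theta> * \<sigma> * \<tau> * L\<^sup>2 = q" and C: "C = 1 / sqrt (1 - q)"
    using assms(17,22) by (simp_all add: mult_ac)
  show ?thesis
    unfolding weight q C
  proof (intro conjI allI impI; (elim conjE)?)
    fix M :: "'w measure" and \<xi> \<pi>\<^sub>0 \<pi>\<^sub>0' X X\<^sub>\<theta> Y X' X\<^sub>\<theta>' Y' N
    assume M: "prob_space M" and pd: "pd_langevin K f g \<tau> \<sigma> \<theta> M \<xi> \<pi>\<^sub>0 X X\<^sub>\<theta> Y"
      and pd': "pd_langevin K f g \<tau> \<sigma> \<theta> M \<xi> \<pi>\<^sub>0' X' X\<^sub>\<theta>' Y'"
      and inputs: "gaussian_inputs M \<xi> (\<lambda>w. (X 0 w, Y 0 w, X' 0 w, Y' 0 w))"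
    have Z: "(\<lambda>w. (X 0 w, Y 0 w, X' 0 w, Y' 0 w)) \<in> borel_measurable M"
      using pd pd' unfolding pd_langevin_def by (intro borel_measurable_Pair) auto
    have h: "(\<lambda>z. (fst z, fst (snd z))) \<in> borel_measurable (borel :: ((real^'d) \<times> (real^'m) \<times> (real^'d) \<times> (real^'m)) measure)"
      by (intro borel_measurable_continuous_onI continuous_intros)
    have h': "(\<lambda>z. snd (snd z)) \<in> borel_measurable (borel :: ((real^'d) \<times> (real^'m) \<times> (real^'d) \<times> (real^'m)) measure)"
      by (intro borel_measurable_continuous_onI continuous_intros)
    note law = langevin_law[OF M pd inputs Z h] and law' = langevin_law[OF M pd' inputs Z h']
    show "wasserstein2 (distr M borel (X N)) (distr M borel (X' N))
        \<le> ennreal (\<theta> powr (real N / 2)) * transport 1 weight \<pi>\<^sub>0 \<pi>\<^sub>0'"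
      by (simp only: law(1)[simplified] law'(1)[simplified] primal_contraction)
    assume "q < 1"
    then show "transport 1 weight (distr M borel (\<lambda>w. (X N w, Y N w))) (distr M borel (\<lambda>w. (X' N w, Y' N w)))
        \<le> ennreal (1 / sqrt (1 - q) * \<theta> powr (real N / 2)) * transport 1 weight \<pi>\<^sub>0 \<pi>\<^sub>0'"
      by (simp only: law(2)[simplified] law'(2)[simplified] primal_dual_contraction)
  next
    assume q: "q < 1"
    obtain \<rho> where \<rho>: "\<rho> \<in> P2" "push step std_gaussian \<rho> = \<rho>" using invariant_law[OF q] by blast
    show "\<exists>\<pi>\<in>P2. pd_stationary K f g \<tau> \<sigma> \<theta> \<pi> \<and>
          (\<forall>(M :: 'w measure) \<xi> \<pi>\<^sub>0 X X\<^sub>\<theta> Y.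
             prob_space M \<and> \<pi>\<^sub>0 \<in> P2 \<and>
             pd_langevin K f g \<tau> \<sigma> \<theta> M \<xi> \<pi>\<^sub>0 X X\<^sub>\<theta> Y \<and>
             gaussian_inputs M \<xi> (\<lambda>w. (X 0 w, Y 0 w))
             \<longrightarrow>
             (\<lambda>N. transport 1 weight (distr M borel (\<lambda>w. (X N w, Y N w))) \<pi>)
               \<longlonglongrightarrow> 0)"
    proof (intro bexI[of _ "distr \<rho> borel observe"] conjI allI impI; (elim conjE)?)
      show "distr \<rho> borel observe \<in> P2" by (rule observe_P2[OF \<rho>(1)])
      show "pd_stationary K f g \<tau> \<sigma> \<theta> (distr \<rho> borel observe)"
        unfolding pd_stationary_def using \<rho> by (intro bexI[of _ \<rho>]) (auto simp: push_def observe_def P2_def)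
      fix M :: "'w measure" and \<xi> \<pi>\<^sub>0 X X\<^sub>\<theta> Y
      assume M: "prob_space M" and \<pi>: "\<pi>\<^sub>0 \<in> P2" and pd: "pd_langevin K f g \<tau> \<sigma> \<theta> M \<xi> \<pi>\<^sub>0 X X\<^sub>\<theta> Y"
        and inputs: "gaussian_inputs M \<xi> (\<lambda>w. (X 0 w, Y 0 w))"
      have Z: "(\<lambda>w. (X 0 w, Y 0 w)) \<in> borel_measurable M"
        using pd unfolding pd_langevin_def by (intro borel_measurable_Pair) auto
      have law: "distr M borel (\<lambda>w. (X N w, Y N w)) = distr ((push step std_gaussian ^^ N) (distr \<pi>\<^sub>0 borel embed)) borel observe" for N
        by (rule langevin_law(2)[OF M pd inputs Z, where h = "\<lambda>z. z"]) auto
      show "(\<lambda>N. transport 1 weight (distr M borel (\<lambda>w. (X N w, Y N w))) (distr \<rho> borel observe)) \<longlonglongrightarrow> 0"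
        unfolding law by (rule converges_to_invariant_law[OF q \<rho> embed_P2[OF \<pi>]])
    qed
  qed
qed

end
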